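(* Let $\mathbb{K}$ be an algebraically closed field of characteristic $\neq 2$ and let $\alpha_1\in\mathbb{K}$ with $\alpha_1\neq 0$. Then the algebra $\mathcal{D}_3(\alpha_1,3\alpha_1)$ can be presented as a quiver with relations (that is, it is isomorphic to the path algebra over $\mathbb{K}$ of a quiver modulo relations) in the following way. The quiver has two vertices $1$ and $2$, two arrows $u_{12},v_{12}$ from $1$ to $2$ and two arrows $u_{21},v_{21}$ from $2$ to $1$. The relations are $$u_{ij}v_{ji}=v_{ij}u_{ji},\qquad u_{ij}v_{ji}+v_{ij}w_{ji}+u_{ij}w_{ji}=0,\qquad u_{ij}v_{ji}w_{ij}=0$$ for all $i,j\in\{1,2\}$ with $i+j=3$, where $w_{kl}=-u_{kl}-v_{kl}$ for all $k,l\in\{1,2\}$ with $k+l=3$.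
   Context: For $\alpha_1,\alpha_2\in\mathbb{K}$, $\mathcal{D}_3(\alpha_1,\alpha_2)$ denotes the associative unital $\mathbb{K}$-algebra given by generators $a,b,c$ and relations $$a^2=b^2=c^2=\alpha_1,\qquad ca+bc+ab=\alpha_2,\qquad cb+ba+ac=\alpha_2.$$ In the path algebra, paths are written from left to right: for instance $u_{ij}v_{ji}$ is the path which goes first along $u_{ij}$ from $i$ to $j$ and then along $v_{ji}$ from $j$ to $i$. *)

theory Defs
  imports
    "HOL-Algebra.QuotRing"
    "HOL-Algebra.Module"
    "HOL-Library.Poly_Mapping"
    "HOL-Computational_Algebra.Polynomial"
    "Graph_Theory.Arc_Walk"
begin

section \<open>Associative unital algebras\<close>

text \<open>
  A \<open>\<bbbK>\<close>-algebra is a record of type \<^typ>\<open>('k, 'a) module\<close>, the scalars being all of the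
  type \<^typ>\<open>'k\<close>. The locale \<^locale>\<open>algebra\<close> of the library is not used, since it is about
  commutative algebras. In contrast, \<^locale>\<open>ideal\<close>, \<^const>\<open>genideal\<close> and \<^const>\<open>FactRing\<close>
  deal with two-sided ideals of arbitrary unital rings; the ring ideals of a unital algebra
  are closed under scalars.
\<close>

definition quot_algebra :: "('k, 'a) module \<Rightarrow> 'a set \<Rightarrow> ('k, 'a set) module" where
  "quot_algebra A I =
    \<lparr>carrier = carrier (A Quot I), monoid.mult = monoid.mult (A Quot I), one = monoid.one (A Quot I),
     ring.zero = ring.zero (A Quot I), add = ring.add (A Quot I),
     module.smult = (\<lambda>k X. \<Union>x\<in>X. I +>\<^bsub>A\<^esub> (k \<odot>\<^bsub>A\<^esub> x))\<rparr>"

definition presented_algebra :: "('k, 'a) module \<Rightarrow> 'a set \<Rightarrow> ('k, 'a set) module" where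
  "presented_algebra A R = quot_algebra A (Idl\<^bsub>A\<^esub> R)"

definition algebra_iso :: "('k, 'a) module \<Rightarrow> ('k, 'b) module \<Rightarrow> ('a \<Rightarrow> 'b) set" where
  "algebra_iso A B =
    {h \<in> ring_iso A B. \<forall>k. \<forall>x\<in>carrier A. h (k \<odot>\<^bsub>A\<^esub> x) = k \<odot>\<^bsub>B\<^esub> h x}"

definition algebra_isomorphic :: "('k, 'a) module \<Rightarrow> ('k, 'b) module \<Rightarrow> bool" where
  "algebra_isomorphic A B \<longleftrightarrow> algebra_iso A B \<noteq> {}"


section \<open>The free algebra\<close>

text \<open>
  The multiplication of \<^typ>\<open>'m \<Rightarrow>\<^sub>0 'k\<close> in the library is the convolution product for an
  additively written, possibly non-commutative monoid \<^typ>\<open>'m\<close>. For the free monoid it is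
  the product of the free algebra.
\<close>

datatype 'x free_monoid = Word (letters: "'x list")

instantiation free_monoid :: (type) monoid_add
begin

definition zero_free_monoid :: "'a free_monoid" where
  "0 = Word []"

definition plus_free_monoid :: "'a free_monoid \<Rightarrow> 'a free_monoid \<Rightarrow> 'a free_monoid" where
  "v + w = Word (letters v @ letters w)"

instance
  by standard (simp_all add: zero_free_monoid_def plus_free_monoid_def)

end

definition free_algebra :: "('k::field, 'x free_monoid \<Rightarrow>\<^sub>0 'k) module" where
  "free_algebra =
    \<lparr>carrier = UNIV, monoid.mult = (*), one = 1, ring.zero = 0, add = (+),
     module.smult = (\<lambda>k. Poly_Mapping.map ((*) k))\<rparr>"

definition free_gen :: "'x \<Rightarrow> 'x free_monoid \<Rightarrow>\<^sub>0 'k::field" where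
  "free_gen x = Poly_Mapping.single (Word [x]) 1"

abbreviation free_const :: "'k::field \<Rightarrow> 'x free_monoid \<Rightarrow>\<^sub>0 'k" where
  "free_const \<equiv> Poly_Mapping.single 0"


section \<open>The algebra \<open>\<D>\<^sub>3(\<alpha>\<^sub>1, \<alpha>\<^sub>2)\<close>\<close>

datatype D3_gen = GenA | GenB | GenC

definition D3_relations :: "'k::field \<Rightarrow> 'k \<Rightarrow> (D3_gen free_monoid \<Rightarrow>\<^sub>0 'k) set" where
  "D3_relations \<alpha>\<^sub>1 \<alpha>\<^sub>2 =
    (let a = free_gen GenA; b = free_gen GenB; c = free_gen GenC in
      {a * a - free_const \<alpha>\<^sub>1, b * b - free_const \<alpha>\<^sub>1, c * c - free_const \<alpha>\<^sub>1,
       c * a + b * c + a * b - free_const \<alpha>\<^sub>2,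
       c * b + b * a + a * c - free_const \<alpha>\<^sub>2})"

definition D3 :: "'k::field \<Rightarrow> 'k \<Rightarrow> ('k, (D3_gen free_monoid \<Rightarrow>\<^sub>0 'k) set) module" where
  "D3 \<alpha>\<^sub>1 \<alpha>\<^sub>2 = presented_algebra free_algebra (D3_relations \<alpha>\<^sub>1 \<alpha>\<^sub>2)"


section \<open>Path algebras\<close>

text \<open>
  A quiver is a \<^typ>\<open>('v, 'e) pre_digraph\<close>; an arrow \<open>e\<close> goes from \<^term>\<open>tail Q e\<close> to
  \<^term>\<open>head Q e\<close>. The triple \<open>(s, p, t)\<close> stands for the path from \<open>s\<close> to \<open>t\<close> whose arrows,
  in the order in which they are traversed, are those of the list \<open>p\<close>. The triple
  \<open>(v, [], v)\<close> is the trivial path at \<open>v\<close>.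
\<close>

type_synonym ('v, 'e) path = "'v \<times> 'e list \<times> 'v"

definition paths :: "('v, 'e) pre_digraph \<Rightarrow> ('v, 'e) path set" where
  "paths Q = {(s, p, t). pre_digraph.awalk Q s p t}"

definition path_mult ::
    "(('v, 'e) path \<Rightarrow>\<^sub>0 'k::field) \<Rightarrow> (('v, 'e) path \<Rightarrow>\<^sub>0 'k) \<Rightarrow> (('v, 'e) path \<Rightarrow>\<^sub>0 'k)"
    (infixl \<open>\<star>\<close> 70) where
  "f \<star> g =
    (\<Sum>(s, p, t)\<in>Poly_Mapping.keys f. \<Sum>(s', p', t')\<in>Poly_Mapping.keys g.
      if t = s'
      then Poly_Mapping.single (s, p @ p', t')
             (Poly_Mapping.lookup f (s, p, t) * Poly_Mapping.lookup g (s', p', t'))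
      else 0)"

text \<open>The unit is meaningful only for quivers with finitely many vertices.\<close>

definition path_algebra ::
    "('v, 'e) pre_digraph \<Rightarrow> ('k::field, ('v, 'e) path \<Rightarrow>\<^sub>0 'k) module" where
  "path_algebra Q =
    \<lparr>carrier = {f. Poly_Mapping.keys f \<subseteq> paths Q}, monoid.mult = (\<star>),
     one = (\<Sum>v\<in>verts Q. Poly_Mapping.single (v, [], v) 1), ring.zero = 0, add = (+),
     module.smult = (\<lambda>k. Poly_Mapping.map ((*) k))\<rparr>"

definition path_arrow :: "('v, 'e) pre_digraph \<Rightarrow> 'e \<Rightarrow> (('v, 'e) path \<Rightarrow>\<^sub>0 'k::field)" where
  "path_arrow Q e = Poly_Mapping.single (tail Q e, [e], head Q e) 1"


section \<open>The quiver with relations\<close>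

datatype arrow_label = U | V

type_synonym arrow = "arrow_label \<times> nat \<times> nat"

definition Q2 :: "(nat, arrow) pre_digraph" where
  "Q2 = \<lparr>verts = {1, 2},
         arcs = {(U, 1, 2), (V, 1, 2), (U, 2, 1), (V, 2, 1)},
         tail = (\<lambda>(l, i, j). i), head = (\<lambda>(l, i, j). j)\<rparr>"

definition arr_u :: "nat \<Rightarrow> nat \<Rightarrow> ((nat, arrow) path \<Rightarrow>\<^sub>0 'k::field)" where
  "arr_u i j = path_arrow Q2 (U, i, j)"

definition arr_v :: "nat \<Rightarrow> nat \<Rightarrow> ((nat, arrow) path \<Rightarrow>\<^sub>0 'k::field)" where
  "arr_v i j = path_arrow Q2 (V, i, j)"

definition arr_w :: "nat \<Rightarrow> nat \<Rightarrow> ((nat, arrow) path \<Rightarrow>\<^sub>0 'k::field)" where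
  "arr_w i j = - arr_u i j - arr_v i j"

definition Q2_relations :: "((nat, arrow) path \<Rightarrow>\<^sub>0 'k::field) set" where
  "Q2_relations =
    (\<Union>(i, j)\<in>{(i, j). i \<in> {1, 2} \<and> j \<in> {1, 2} \<and> i + j = 3}.
      {arr_u i j \<star> arr_v j i - arr_v i j \<star> arr_u j i,
       arr_u i j \<star> arr_v j i + arr_v i j \<star> arr_w j i + arr_u i j \<star> arr_w j i,
       arr_u i j \<star> arr_v j i \<star> arr_w i j})"

end

(*
  Let R = K[u,v]/(u^2 + uv + v^2, uv(u + v)). The path algebra modulo the relations is the
  skew group algebra of R and Z/2 acting by u -> -u, v -> -v, with sigma = e_1 - e_2 generating
  the group, u = u_12 + u_21 and v = v_12 + v_21. Write E(t) = 1 + 2t + 2t^2 (the exponential of 2t,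
  as the cubes of u, v and u + v vanish) and alpha_1 = s^2. Then a -> s sigma, b -> s sigma E(u),
  c -> s sigma E(u + v) is the isomorphism.

  For the inverse one may take s = 1. In D_3(1, 3) the elements P = ab, Q = bc, S = ca commute,
  and (T - P)(T - Q)(T - S) = (T - 1)^3. Hence 4u = P - P^(-1) and 4v = Q - Q^(-1) satisfy the
  relations of R, and a acts on them by -1.
*)
theory Submission
  imports Defs
begin

section \<open>Ring identities\<close>

text \<open>Put w = -u - v. The relations of R say that the elementary symmetric polynomials of u,
  v, w vanish, so R is the coinvariant algebra of S_3, and the cubes vanish because (T - u)(T - v)(T
  - w) = T^3. The elements P, Q, S play the role of exp(2u), exp(2v), exp(2w). Here PQS = 1 is
  automatic, and once a, b, c are involutions the two linear relations read P + Q + S = 3 and P^(-1)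
  + Q^(-1) + S^(-1) = 3. The formula for 4u is exp(2u) - exp(-2u) up to cubes; it replaces a
  logarithm and, like E, needs only 2 to be invertible, so characteristic 3 is no exception.

  The obstacle is where to compute. The quotients are records with carriers, whereas noncommutative
  words are normalized conveniently in the class \<open>ring_1\<close>. Hence the identities live in
  locales over an arbitrary ring, and each quotient is turned into a type. A type cannot depend on
  the value of s, so on the D_3 side only D_3(1, 3) becomes one; D_3(s^2, 3 s^2) is reached by
  rescaling generators.\<close>

text \<open>Small integers are written as sums of units, which the distributive laws normalize in any ring.\<close>

definition exp2 :: "'a::ring_1 \<Rightarrow> 'a" where
  "exp2 t = 1 + t + t + t * t + t * t"

lemma mult_cancel_left_assoc:
  fixes x y :: "'a::monoid_mult"
  assumes "x * y = 1"
  shows "x * (y * r) = r"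
  using assms by (simp flip: mult.assoc)

section \<open>The skew group algebra of R, by its relations in an arbitrary ring\<close>

locale coinvariant_pair =
  fixes \<sigma> u v :: "'a::ring_1"
  assumes sq: "\<sigma> * \<sigma> = 1"
    and anti_u: "u * \<sigma> = - (\<sigma> * u)"
    and anti_v: "v * \<sigma> = - (\<sigma> * v)"
    and comm: "v * u = u * v"
    and quadratic: "u * u + u * v + v * v = 0"
    and cubic: "u * v * (u + v) = 0"
begin

lemma vv: "v * v = - (u * u) - u * v"
  using quadratic by (simp add: add_eq_0_iff)

lemma uvv: "u * (v * v) = - (u * (u * v))"
  using cubic by (simp add: distrib_left mult.assoc comm add_eq_0_iff)

text \<open>Multiplying the quadratic relation by \<open>u\<close> gives u^3 + u^2 v + u v^2, and
  the cubic relation removes the last two terms.\<close>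

lemma uuu: "u * (u * u) = 0"
  using uvv unfolding vv by (simp add: algebra_simps)

text \<open>Rules for right-nested words: \<sigma> moves to the left, \<open>u\<close> in front of
  \<open>v\<close>, and v^2 is eliminated. The words that survive are \<sigma>^i u^j v^k with i, k
  at most 1 and j at most 2, so identities are settled by normalization.\<close>

lemma rewr:
  "\<sigma> * (\<sigma> * r) = r"
  "u * (\<sigma> * r) = - (\<sigma> * (u * r))"
  "v * (\<sigma> * r) = - (\<sigma> * (v * r))"
  "v * (u * r) = u * (v * r)"
  "v * (v * r) = - (u * (u * r)) - u * (v * r)"
  "u * (u * (u * r)) = 0"
  using sq anti_u anti_v comm vv uuu
  by (simp_all add: left_diff_distrib flip: mult.assoc)

lemmas normalize = sq anti_u anti_v comm vv uuu rewr algebra_simps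

text \<open>As \<sigma> changes the signs of \<open>u\<close> and \<open>v\<close>, the products are
  exponentials: \<open>\<sigma> * y\<close> = E(u), \<open>y * z\<close> = E(-u) E(u + v) = E(v),
  \<open>z * \<sigma>\<close> = E(-u - v). Their sum is 3 + 4(u^2 + uv + v^2). The last two
  equations are E(t) - E(-t) = 4t; they recover \<open>u\<close> and \<open>v\<close> from the
  generators and serve surjectivity.\<close>

lemma D3_relations_hold:
  defines "y \<equiv> \<sigma> * exp2 u" and "z \<equiv> \<sigma> * exp2 (u + v)"
  shows "y * y = 1" and "z * z = 1"
    and "z * \<sigma> + y * z + \<sigma> * y = 1 + 1 + 1"
    and "z * y + y * \<sigma> + \<sigma> * z = 1 + 1 + 1"
    and "\<sigma> * y - y * \<sigma> = u + u + u + u"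
    and "y * z - z * y = v + v + v + v"
  unfolding assms exp2_def by (simp_all add: normalize del: one_add_one)

end

section \<open>The relations of D_3(1, 3) in an arbitrary ring\<close>

locale D3_triple =
  fixes x y z :: "'a::ring_1"
  assumes xx: "x * x = 1" and yy: "y * y = 1" and zz: "z * z = 1"
    and rel1: "z * x + y * z + x * y = 1 + 1 + 1"
    and rel2: "z * y + y * x + x * z = 1 + 1 + 1"
begin

lemma cancel: "x * (x * r) = r" "y * (y * r) = r" "z * (z * r) = r"
  using xx yy zz by (simp_all add: mult_cancel_left_assoc)

text \<open>Conjugation by \<open>y\<close> turns \<open>rel1\<close> into yz xy + zy + yx = 3.
  Comparison with \<open>rel2\<close> leaves yz xy = xz, and xz = xy yz because y^2 = 1.\<close>

lemma commute_xy_yz: "x * y * (y * z) = y * z * (x * y)"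
proof -
  have "y * (z * x + y * z + x * y) * y = y * (1 + 1 + 1) * y"
    unfolding rel1 ..
  then have "y * z * (x * y) + z * y + y * x = z * y + y * x + x * z"
    unfolding rel2 by (simp only: distrib_left distrib_right mult.assoc cancel yy mult_1_left mult_1_right)
  then show ?thesis
    by (simp add: mult.assoc cancel)
qed

text \<open>Both linear relations are invariant under the rotation of the three generators, so one
  commutation yields the other two.\<close>

lemma cyclic: "D3_triple y z x"
  using xx yy zz rel1 rel2 by unfold_locales (simp_all only: add_ac)

lemma commute_yz_zx: "y * z * (z * x) = z * x * (y * z)"
  using D3_triple.commute_xy_yz[OF cyclic] .

text \<open>The unipotent elements P and Q are shifted by 1 to nilpotent ones; \<open>rel1\<close>
  then makes S = 1 - p - q, and everything becomes a polynomial in two commuting variables.\<close>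

definition p where "p = x * y - 1"
definition q where "q = y * z - 1"

lemma pq_comm: "q * p = p * q"
  using commute_xy_yz by (simp add: p_def q_def algebra_simps)

lemma xy: "x * y = 1 + p" and yz: "y * z = 1 + q"
  by (simp_all add: p_def q_def)

lemma zx: "z * x = 1 - p - q"
proof -
  have "z * x = 1 + 1 + 1 - x * y - y * z"
    unfolding rel1[symmetric] by simp
  then show ?thesis
    by (simp add: xy yz del: one_add_one)
qed

text \<open>Since PQS = 1 with commuting factors, the inverse of each factor is the product of the
  other two.\<close>

lemma xz: "x * z = (1 + p) * (1 + q)" and yx: "y * x = (1 + q) * (1 - p - q)"
  and zy: "z * y = (1 - p - q) * (1 + p)"
  unfolding xy[symmetric] yz[symmetric] zx[symmetric] by (simp_all add: mult.assoc cancel)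

text \<open>By the product formulas, \<open>rel2\<close> says PQ + QS + SP = 3, and the left side
  expands to 3 - (p^2 + pq + q^2).\<close>

lemma qq: "q * q = - (p * p) - p * q"
proof -
  have "p * p + (p * q + q * q) = 0"
    using rel2 unfolding xz yx zy by (simp add: algebra_simps pq_comm del: one_add_one)
  then show ?thesis
    by (simp add: algebra_simps add_eq_0_iff)
qed

lemma pq_rewr:
  "q * (p * r) = p * (q * r)"
  "q * (q * r) = - (p * (p * r)) - p * (q * r)"
  using pq_comm qq by (simp_all add: left_diff_distrib flip: mult.assoc)

text \<open>This is PQS = 1: the product expands to 1 - (p^2 + pq + q^2) - pq(p + q), which the
  quadratic relation reduces to 1 + p^3.\<close>

lemma ppp: "p * (p * p) = 0"
proof -
  have "(1 + p) * (1 + q) * (1 - p - q) = x * z * (z * x)"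
    unfolding xz zx ..
  also have "\<dots> = 1"
    by (simp add: mult.assoc cancel xx)
  also have "(1 + p) * (1 + q) * (1 - p - q) = 1 + p * (p * p)"
    by (simp add: distrib_left distrib_right left_diff_distrib right_diff_distrib mult.assoc pq_comm qq pq_rewr)
  finally show ?thesis
    by simp
qed

lemma ppp_left: "p * (p * (p * r)) = 0"
  using ppp by (metis mult.assoc mult_zero_left)

lemmas normalize = pq_comm qq ppp pq_rewr ppp_left
  distrib_left distrib_right left_diff_distrib right_diff_distrib mult.assoc

end

text \<open>A general \<open>ring_1\<close> has no division, so the scalar 1/4 enters as a central
  element \<open>h\<close>.\<close>

locale D3_triple_quarter = D3_triple x y z for x y z :: "'a::ring_1" +
  fixes h :: 'a
  assumes central: "r * h = h * r" and quarter: "h + h + h + h = 1"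
begin

definition u where "u = h * (x * y - y * x)"
definition v where "v = h * (y * z - z * y)"

lemma quarter_mult: "h * (r + r + r + r) = r"
proof -
  have "h * (r + r + r + r) = (h + h + h + h) * r"
    by (simp only: distrib_left distrib_right)
  then show ?thesis
    by (simp only: quarter mult_1_left)
qed

lemma central_mult: "(h * r) * (h * s) = h * (h * (r * s))"
proof -
  have "(h * r) * (h * s) = h * (r * h) * s"
    by (simp only: mult.assoc)
  then show ?thesis
    by (simp only: central mult.assoc)
qed

text \<open>Because p^3 = 0, the inverse of P = 1 + p is 1 - p + p^2, whence P - P^(-1) = 2p - p^2.
  In the same way Q - Q^(-1) = 2q - q^2, where q^2 is then eliminated.\<close>

lemma u_p: "u = h * (p + p - p * p)"
  unfolding u_def xy yx by (simp add: normalize)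

lemma v_q: "v = h * (q + q + p * p + p * q)"
  unfolding v_def yz zy by (simp add: normalize)

lemma u_v_p_q: "u + v = h * (p + p + q + q + p * q)"
  unfolding u_p v_q by (simp add: algebra_simps)

lemma uu: "u * u = h * (p * p)"
proof -
  have "u * u = h * (h * ((p + p - p * p) * (p + p - p * p)))"
    unfolding u_p by (rule central_mult)
  also have "(p + p - p * p) * (p + p - p * p) = p * p + p * p + p * p + p * p"
    by (simp add: normalize)
  finally show ?thesis
    by (simp only: quarter_mult)
qed

lemma uv: "u * v = h * (p * q)"
proof -
  have "u * v = h * (h * ((p + p - p * p) * (q + q + p * p + p * q)))"
    unfolding u_p v_q by (rule central_mult)
  \<comment> \<open>The two terms in p^2 q cancel and the others of degree at least three contain
    p^3; the remaining 4 consumes one of the two factors \<open>h\<close>.\<close>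
  also have "(p + p - p * p) * (q + q + p * p + p * q) =
      p * q + p * q + p * q + p * q"
    by (simp add: normalize)
  finally show ?thesis
    by (simp only: quarter_mult)
qed

lemma vv: "v * v = h * (q * q)"
proof -
  have "v * v = h * (h * ((q + q + p * p + p * q) * (q + q + p * p + p * q)))"
    unfolding v_q by (rule central_mult)
  also have "(q + q + p * p + p * q) * (q + q + p * p + p * q) = q * q + q * q + q * q + q * q"
    by (simp add: normalize)
  finally show ?thesis
    by (simp only: quarter_mult)
qed

lemma vu: "v * u = u * v"
proof -
  have "v * u = h * (h * ((q + q + p * p + p * q) * (p + p - p * p)))"
    unfolding u_p v_q by (rule central_mult)
  also have "(q + q + p * p + p * q) * (p + p - p * p) = p * q + p * q + p * q + p * q"
    by (simp add: normalize)
  finally show ?thesis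
    by (simp only: quarter_mult uv)
qed

lemma quadratic: "u * u + u * v + v * v = 0"
  unfolding uu uv vv by (simp add: qq distrib_left right_diff_distrib)

text \<open>After the factors \<open>h\<close> are pulled out, pq(p + q) = -p^3 = 0 and (pq)^2 = 0
  remain.\<close>

lemma cubic: "u * v * (u + v) = 0"
proof -
  have "u * v * (u + v) = h * (h * (p * q * (p + p + q + q + p * q)))"
    unfolding uv u_v_p_q by (rule central_mult)
  also have "p * q * (p + p + q + q + p * q) = 0"
    by (simp add: normalize)
  finally show ?thesis
    by simp
qed

text \<open>The correction -p^2 in \<open>u\<close> is cancelled by the quadratic term of the
  exponential: 2u + 2u^2 = 4hp = p. Thus E(u) = P = xy, and multiplication by the involution
  \<open>x\<close> gives \<open>y\<close>.\<close>

lemma exp2_u: "x * exp2 u = y"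
proof -
  have "exp2 u = 1 + h * (p + p + p + p)"
    unfolding exp2_def uu unfolding u_p by (simp add: algebra_simps)
  also have "\<dots> = x * y"
    unfolding xy quarter_mult ..
  finally show ?thesis
    by (simp add: cancel)
qed

text \<open>The quadratic relation turns (u + v)^2 into uv, hence E(u + v) = 1 + 4h(p + q + pq) = (1
  + p)(1 + q) = PQ = xz.\<close>

lemma exp2_u_v: "x * exp2 (u + v) = z"
proof -
  have "(u + v) * (u + v) = u * v + (u * u + u * v + v * v)"
    by (simp add: algebra_simps vu)
  also have "\<dots> = h * (p * q)"
    unfolding quadratic by (simp add: uv)
  finally have *: "(u + v) * (u + v) = h * (p * q)" .
  have "exp2 (u + v) = 1 + h * ((p + q + p * q) + (p + q + p * q) + (p + q + p * q) + (p + q + p * q))"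
    unfolding exp2_def * unfolding u_v_p_q by (simp add: algebra_simps)
  also have "\<dots> = x * z"
    unfolding xz quarter_mult by (simp add: algebra_simps)
  finally show ?thesis
    by (simp add: cancel)
qed

lemma anti_u: "u * x = - (x * u)"
proof -
  have "x * u = h * (x * (x * y - y * x))"
    unfolding u_def by (metis central mult.assoc)
  then show ?thesis
    unfolding u_def by (simp add: algebra_simps cancel xx)
qed

text \<open>Conjugation by \<open>x\<close> inverts Q: as zx and xy commute, zy = zx xy = xy zx =
  x(yz)x. It inverts P = xy trivially, so both \<open>u\<close> and \<open>v\<close> anticommute
  with \<open>x\<close>.\<close>

lemma conj_x: "x * (y * z) = z * (y * x)" "x * (z * y) = y * (z * x)"
proof -
  have *: "z * x * (x * y) = x * y * (z * x)"
    using D3_triple.commute_yz_zx[OF cyclic] .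
  have "z * (y * x) = z * x * (x * y) * x"
    by (simp add: mult.assoc cancel)
  then show "x * (y * z) = z * (y * x)"
    unfolding * by (simp add: mult.assoc xx)
  have "x * (z * y) = x * (z * x * (x * y))"
    by (simp add: mult.assoc cancel)
  then show "x * (z * y) = y * (z * x)"
    unfolding * by (simp add: mult.assoc cancel)
qed

lemma anti_v: "v * x = - (x * v)"
proof -
  have "x * v = h * (x * (y * z - z * y))"
    unfolding v_def by (metis central mult.assoc)
  then show ?thesis
    unfolding v_def by (simp add: algebra_simps conj_x)
qed

sublocale coinvariant_pair x u v
  by unfold_locales (fact xx anti_u anti_v vu quadratic cubic)+

end

section \<open>From vertices and arrows to \<sigma>, u, v\<close>

locale two_cycle_rep =
  fixes e\<^sub>1 e\<^sub>2 u\<^sub>1\<^sub>2 v\<^sub>1\<^sub>2 u\<^sub>2\<^sub>1 v\<^sub>2\<^sub>1 :: "'a::ring_1"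
  assumes idem: "e\<^sub>1 * e\<^sub>1 = e\<^sub>1" "e\<^sub>2 * e\<^sub>2 = e\<^sub>2" and orth: "e\<^sub>1 * e\<^sub>2 = 0" "e\<^sub>2 * e\<^sub>1 = 0"
    and unit: "e\<^sub>1 + e\<^sub>2 = 1"
    and sources: "e\<^sub>1 * u\<^sub>1\<^sub>2 = u\<^sub>1\<^sub>2" "e\<^sub>1 * v\<^sub>1\<^sub>2 = v\<^sub>1\<^sub>2" "e\<^sub>2 * u\<^sub>2\<^sub>1 = u\<^sub>2\<^sub>1" "e\<^sub>2 * v\<^sub>2\<^sub>1 = v\<^sub>2\<^sub>1"
    and targets: "u\<^sub>1\<^sub>2 * e\<^sub>2 = u\<^sub>1\<^sub>2" "v\<^sub>1\<^sub>2 * e\<^sub>2 = v\<^sub>1\<^sub>2" "u\<^sub>2\<^sub>1 * e\<^sub>1 = u\<^sub>2\<^sub>1" "v\<^sub>2\<^sub>1 * e\<^sub>1 = v\<^sub>2\<^sub>1"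
begin

lemma target_source_mismatch:
  assumes "x * e\<^sub>1 = x" and "e\<^sub>2 * y = y" shows "x * y = 0"
  using assms orth by (metis mult.assoc mult_zero_left mult_zero_right)

lemma source_target_mismatch:
  assumes "x * e\<^sub>2 = x" and "e\<^sub>1 * y = y" shows "x * y = 0"
  using assms orth by (metis mult.assoc mult_zero_left mult_zero_right)

lemma vanishing:
  "u\<^sub>1\<^sub>2 * u\<^sub>1\<^sub>2 = 0" "u\<^sub>1\<^sub>2 * v\<^sub>1\<^sub>2 = 0" "v\<^sub>1\<^sub>2 * u\<^sub>1\<^sub>2 = 0" "v\<^sub>1\<^sub>2 * v\<^sub>1\<^sub>2 = 0"
  "u\<^sub>2\<^sub>1 * u\<^sub>2\<^sub>1 = 0" "u\<^sub>2\<^sub>1 * v\<^sub>2\<^sub>1 = 0" "v\<^sub>2\<^sub>1 * u\<^sub>2\<^sub>1 = 0" "v\<^sub>2\<^sub>1 * v\<^sub>2\<^sub>1 = 0"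
  "e\<^sub>2 * u\<^sub>1\<^sub>2 = 0" "e\<^sub>2 * v\<^sub>1\<^sub>2 = 0" "e\<^sub>1 * u\<^sub>2\<^sub>1 = 0" "e\<^sub>1 * v\<^sub>2\<^sub>1 = 0"
  "u\<^sub>1\<^sub>2 * e\<^sub>1 = 0" "v\<^sub>1\<^sub>2 * e\<^sub>1 = 0" "u\<^sub>2\<^sub>1 * e\<^sub>2 = 0" "v\<^sub>2\<^sub>1 * e\<^sub>2 = 0"
  using target_source_mismatch source_target_mismatch idem sources targets by blast+

lemma vanishing_left:
  "u\<^sub>1\<^sub>2 * (u\<^sub>1\<^sub>2 * r) = 0" "u\<^sub>1\<^sub>2 * (v\<^sub>1\<^sub>2 * r) = 0" "v\<^sub>1\<^sub>2 * (u\<^sub>1\<^sub>2 * r) = 0" "v\<^sub>1\<^sub>2 * (v\<^sub>1\<^sub>2 * r) = 0"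
  "u\<^sub>2\<^sub>1 * (u\<^sub>2\<^sub>1 * r) = 0" "u\<^sub>2\<^sub>1 * (v\<^sub>2\<^sub>1 * r) = 0" "v\<^sub>2\<^sub>1 * (u\<^sub>2\<^sub>1 * r) = 0" "v\<^sub>2\<^sub>1 * (v\<^sub>2\<^sub>1 * r) = 0"
  by (simp_all add: vanishing flip: mult.assoc)

text \<open>A product of sums of arrows keeps only the composable terms, so each relation of R is,
  up to sign, the sum of the two quiver relations obtained from (i, j) = (1, 2) and (2, 1).\<close>

lemma coinvariant_pair:
  assumes comm: "u\<^sub>1\<^sub>2 * v\<^sub>2\<^sub>1 = v\<^sub>1\<^sub>2 * u\<^sub>2\<^sub>1" "u\<^sub>2\<^sub>1 * v\<^sub>1\<^sub>2 = v\<^sub>2\<^sub>1 * u\<^sub>1\<^sub>2"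
    and quadratic: "u\<^sub>1\<^sub>2 * v\<^sub>2\<^sub>1 + v\<^sub>1\<^sub>2 * (- u\<^sub>2\<^sub>1 - v\<^sub>2\<^sub>1) + u\<^sub>1\<^sub>2 * (- u\<^sub>2\<^sub>1 - v\<^sub>2\<^sub>1) = 0"
      "u\<^sub>2\<^sub>1 * v\<^sub>1\<^sub>2 + v\<^sub>2\<^sub>1 * (- u\<^sub>1\<^sub>2 - v\<^sub>1\<^sub>2) + u\<^sub>2\<^sub>1 * (- u\<^sub>1\<^sub>2 - v\<^sub>1\<^sub>2) = 0"
    and cubic: "u\<^sub>1\<^sub>2 * v\<^sub>2\<^sub>1 * (- u\<^sub>1\<^sub>2 - v\<^sub>1\<^sub>2) = 0" "u\<^sub>2\<^sub>1 * v\<^sub>1\<^sub>2 * (- u\<^sub>2\<^sub>1 - v\<^sub>2\<^sub>1) = 0"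
  shows "coinvariant_pair (e\<^sub>1 - e\<^sub>2) (u\<^sub>1\<^sub>2 + u\<^sub>2\<^sub>1) (v\<^sub>1\<^sub>2 + v\<^sub>2\<^sub>1)"
proof
  show "(e\<^sub>1 - e\<^sub>2) * (e\<^sub>1 - e\<^sub>2) = 1"
    by (simp add: idem orth unit algebra_simps)
  show "(u\<^sub>1\<^sub>2 + u\<^sub>2\<^sub>1) * (e\<^sub>1 - e\<^sub>2) = - ((e\<^sub>1 - e\<^sub>2) * (u\<^sub>1\<^sub>2 + u\<^sub>2\<^sub>1))"
    by (simp add: algebra_simps sources targets vanishing)
  show "(v\<^sub>1\<^sub>2 + v\<^sub>2\<^sub>1) * (e\<^sub>1 - e\<^sub>2) = - ((e\<^sub>1 - e\<^sub>2) * (v\<^sub>1\<^sub>2 + v\<^sub>2\<^sub>1))"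
    by (simp add: algebra_simps sources targets vanishing)
  show "(v\<^sub>1\<^sub>2 + v\<^sub>2\<^sub>1) * (u\<^sub>1\<^sub>2 + u\<^sub>2\<^sub>1) = (u\<^sub>1\<^sub>2 + u\<^sub>2\<^sub>1) * (v\<^sub>1\<^sub>2 + v\<^sub>2\<^sub>1)"
    by (simp add: algebra_simps vanishing comm)
  \<comment> \<open>Inserting w' = -u' - v' gives uv' + vw' + uw' = -(uu' + vu' + vv'), and vu' =
    uv' makes this the quadratic relation with a minus sign.\<close>
  let ?q = "\<lambda>u v u' v'. u * v' + v * (- u' - v') + u * (- u' - v')"
  have "(u\<^sub>1\<^sub>2 + u\<^sub>2\<^sub>1) * (u\<^sub>1\<^sub>2 + u\<^sub>2\<^sub>1) + (u\<^sub>1\<^sub>2 + u\<^sub>2\<^sub>1) * (v\<^sub>1\<^sub>2 + v\<^sub>2\<^sub>1) + (v\<^sub>1\<^sub>2 + v\<^sub>2\<^sub>1) * (v\<^sub>1\<^sub>2 + v\<^sub>2\<^sub>1)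
    = - ?q u\<^sub>1\<^sub>2 v\<^sub>1\<^sub>2 u\<^sub>2\<^sub>1 v\<^sub>2\<^sub>1 - ?q u\<^sub>2\<^sub>1 v\<^sub>2\<^sub>1 u\<^sub>1\<^sub>2 v\<^sub>1\<^sub>2"
    by (simp add: algebra_simps vanishing comm)
  then show "(u\<^sub>1\<^sub>2 + u\<^sub>2\<^sub>1) * (u\<^sub>1\<^sub>2 + u\<^sub>2\<^sub>1) + (u\<^sub>1\<^sub>2 + u\<^sub>2\<^sub>1) * (v\<^sub>1\<^sub>2 + v\<^sub>2\<^sub>1) + (v\<^sub>1\<^sub>2 + v\<^sub>2\<^sub>1) * (v\<^sub>1\<^sub>2 + v\<^sub>2\<^sub>1) = 0"
    unfolding quadratic by simp
  have "(u\<^sub>1\<^sub>2 + u\<^sub>2\<^sub>1) * (v\<^sub>1\<^sub>2 + v\<^sub>2\<^sub>1) * (u\<^sub>1\<^sub>2 + u\<^sub>2\<^sub>1 + (v\<^sub>1\<^sub>2 + v\<^sub>2\<^sub>1))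
    = - (u\<^sub>1\<^sub>2 * v\<^sub>2\<^sub>1 * (- u\<^sub>1\<^sub>2 - v\<^sub>1\<^sub>2)) - u\<^sub>2\<^sub>1 * v\<^sub>1\<^sub>2 * (- u\<^sub>2\<^sub>1 - v\<^sub>2\<^sub>1)"
    by (simp add: algebra_simps vanishing vanishing_left)
  then show "(u\<^sub>1\<^sub>2 + u\<^sub>2\<^sub>1) * (v\<^sub>1\<^sub>2 + v\<^sub>2\<^sub>1) * (u\<^sub>1\<^sub>2 + u\<^sub>2\<^sub>1 + (v\<^sub>1\<^sub>2 + v\<^sub>2\<^sub>1)) = 0"
    unfolding cubic by simp
qed

end

section \<open>The idempotents of \<sigma> and the way back to the quiver\<close>

locale coinvariant_pair_half = coinvariant_pair \<sigma> u v for \<sigma> u v :: "'a::ring_1" +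
  fixes k :: 'a
  assumes central: "r * k = k * r" and half: "k + k = 1"
begin

definition e\<^sub>1 where "e\<^sub>1 = k * (1 + \<sigma>)"
definition e\<^sub>2 where "e\<^sub>2 = k * (1 - \<sigma>)"

lemma half_mult: "k * (r + r) = r"
proof -
  have "k * (r + r) = (k + k) * r"
    by (simp only: distrib_left distrib_right)
  then show ?thesis
    by (simp only: half mult_1_left)
qed

lemma central_mult: "(k * r) * (k * s) = k * (k * (r * s))"
proof -
  have "(k * r) * (k * s) = k * (r * k) * s"
    by (simp only: mult.assoc)
  then show ?thesis
    by (simp only: central mult.assoc)
qed

lemma unit: "e\<^sub>1 + e\<^sub>2 = 1"
proof -
  have "e\<^sub>1 + e\<^sub>2 = k * (1 + 1)"
    unfolding e\<^sub>1_def e\<^sub>2_def by (simp add: algebra_simps del: one_add_one)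
  then show ?thesis
    by (simp only: half_mult)
qed

lemma sigma: "e\<^sub>1 - e\<^sub>2 = \<sigma>"
proof -
  have "e\<^sub>1 - e\<^sub>2 = k * (\<sigma> + \<sigma>)"
    unfolding e\<^sub>1_def e\<^sub>2_def by (simp add: algebra_simps)
  then show ?thesis
    by (simp only: half_mult)
qed

lemma orth: "e\<^sub>1 * e\<^sub>2 = 0" "e\<^sub>2 * e\<^sub>1 = 0"
  unfolding e\<^sub>1_def e\<^sub>2_def central_mult by (simp_all add: algebra_simps sq)

lemma idem: "e\<^sub>1 * e\<^sub>1 = e\<^sub>1" "e\<^sub>2 * e\<^sub>2 = e\<^sub>2"
  using orth unit by (metis add.right_neutral distrib_left mult_1_right)
    (metis add.left_neutral orth unit distrib_left mult_1_right)

text \<open>Anticommuting with \<sigma> = \<open>e\<^sub>1 - e\<^sub>2\<close> exchanges the two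
  idempotents. Hence \<open>e\<^sub>1 * u\<close> lies in the corner from vertex 1 to vertex 2, as
  an arrow should.\<close>

lemma swap: "u * e\<^sub>2 = e\<^sub>1 * u" "u * e\<^sub>1 = e\<^sub>2 * u" "v * e\<^sub>2 = e\<^sub>1 * v" "v * e\<^sub>1 = e\<^sub>2 * v"
proof -
  have *: "r * (k * s) = k * (r * s)" for r s
    by (simp only: central flip: mult.assoc)
  show "u * e\<^sub>2 = e\<^sub>1 * u" "u * e\<^sub>1 = e\<^sub>2 * u" "v * e\<^sub>2 = e\<^sub>1 * v" "v * e\<^sub>1 = e\<^sub>2 * v"
    unfolding e\<^sub>1_def e\<^sub>2_def *[of u] *[of v] mult.assoc
    by (simp_all add: distrib_left distrib_right left_diff_distrib right_diff_distrib anti_u anti_v)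
qed

lemma swap_left:
  "u * (e\<^sub>2 * r) = e\<^sub>1 * (u * r)" "u * (e\<^sub>1 * r) = e\<^sub>2 * (u * r)"
  "v * (e\<^sub>2 * r) = e\<^sub>1 * (v * r)" "v * (e\<^sub>1 * r) = e\<^sub>2 * (v * r)"
  "e\<^sub>1 * (e\<^sub>1 * r) = e\<^sub>1 * r" "e\<^sub>2 * (e\<^sub>2 * r) = e\<^sub>2 * r"
  by (simp_all only: swap idem flip: mult.assoc)

lemma two_cycle_rep: "two_cycle_rep e\<^sub>1 e\<^sub>2 (e\<^sub>1 * u) (e\<^sub>1 * v) (e\<^sub>2 * u) (e\<^sub>2 * v)"
  by unfold_locales (simp_all add: idem orth unit swap swap_left mult.assoc)

lemma quiver_relations:
  assumes "(e, e') \<in> {(e\<^sub>1, e\<^sub>2), (e\<^sub>2, e\<^sub>1)}"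
  shows "e * u * (e' * v) = e * v * (e' * u)"
    and "e * u * (e' * v) + e * v * (- (e' * u) - e' * v) + e * u * (- (e' * u) - e' * v) = 0"
    and "e * u * (e' * v) * (- (e * u) - e * v) = 0"
proof -
  \<comment> \<open>An inner idempotent moves left through \<open>s\<close>, becomes the outer one
    and is absorbed by it. Alternating products thus reduce to products in R with a single
    idempotent in front.\<close>
  have *: "e * s * (e' * t) = e * (s * t)" "e' * s * (e * t) = e' * (s * t)" if "s \<in> {u, v}" for s t
    using assms that by (auto simp: mult.assoc swap_left)
  show "e * u * (e' * v) = e * v * (e' * u)"
    by (simp add: * comm)
  have "e * u * (e' * v) + e * v * (- (e' * u) - e' * v) + e * u * (- (e' * u) - e' * v)
    = - (e * (u * u + u * v + v * v))"
    by (simp add: right_diff_distrib distrib_left * comm)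
  then show "e * u * (e' * v) + e * v * (- (e' * u) - e' * v) + e * u * (- (e' * u) - e' * v) = 0"
    by (simp add: quadratic)
  have "e * (u * v) * (e * t) = e * (u * v * t)" for t
    using assms by (auto simp: mult.assoc swap_left)
  then have "e * (u * v) * (- (e * u) - e * v) = - (e * (u * v * (u + v)))"
    by (simp add: right_diff_distrib distrib_left)
  then show "e * u * (e' * v) * (- (e * u) - e * v) = 0"
    by (simp add: * cubic)
qed

end

section \<open>Linear extension and evaluation of the free algebra\<close>

lemma poly_mapping_eq_sum_single:
  fixes f :: "'w \<Rightarrow>\<^sub>0 'k::comm_monoid_add"
  shows "f = (\<Sum>w\<in>Poly_Mapping.keys f. Poly_Mapping.single w (Poly_Mapping.lookup f w))"
  by (rule poly_mapping_eqI)
    (auto simp: lookup_sum lookup_single when_def in_keys_iff sum.delta)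

lemma poly_mapping_additive_induct [consumes 1, case_names zero single add]:
  fixes f :: "'w \<Rightarrow>\<^sub>0 'k::comm_monoid_add"
  assumes "Poly_Mapping.keys f \<subseteq> S"
    and zero: "P 0"
    and single: "\<And>w c. w \<in> S \<Longrightarrow> P (Poly_Mapping.single w c)"
    and add: "\<And>f g. Poly_Mapping.keys f \<subseteq> S \<Longrightarrow> Poly_Mapping.keys g \<subseteq> S \<Longrightarrow> P f \<Longrightarrow> P g \<Longrightarrow> P (f + g)"
  shows "P f"
proof -
  \<comment> \<open>The bound on the keys is carried along because the additive case of the
    induction presupposes it for both summands.\<close>
  have "Poly_Mapping.keys (\<Sum>w\<in>X. Poly_Mapping.single w (Poly_Mapping.lookup f w)) \<subseteq> S \<and>
      P (\<Sum>w\<in>X. Poly_Mapping.single w (Poly_Mapping.lookup f w))"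
    if "finite X" "X \<subseteq> S" for X
    using that
  proof (induction X rule: finite_induct)
    case empty
    then show ?case by (simp add: zero)
  next
    case (insert w X)
    have "Poly_Mapping.keys (Poly_Mapping.single w (Poly_Mapping.lookup f w)) \<subseteq> S"
      using insert.prems by simp
    moreover have "P (Poly_Mapping.single w (Poly_Mapping.lookup f w))"
      using insert.prems by (intro single) simp
    ultimately show ?case
      using insert by (simp add: add order.trans[OF Poly_Mapping.keys_add] del: keys_single)
  qed
  from this[of "Poly_Mapping.keys f"] assms(1) show ?thesis
    using poly_mapping_eq_sum_single[of f] by simp
qed

text \<open>The class \<open>ring_1\<close> carries no scalars. A K-algebra structure on a type is
  given as a unital ring homomorphism from K to its center.\<close>

locale central_scalars =
  fixes sc :: "'k::field \<Rightarrow> 'a::ring_1"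
  assumes sc_add: "sc (k + l) = sc k + sc l"
    and sc_mult: "sc (k * l) = sc k * sc l"
    and sc_one: "sc 1 = 1"
    and sc_central: "r * sc k = sc k * r"
begin

lemma sc_zero: "sc 0 = 0"
  using sc_add[of 0 0] by simp

lemma sc_central_left: "r * (sc k * s) = sc k * (r * s)"
  by (metis mult.assoc sc_central)

definition lin_ext :: "('w \<Rightarrow> 'a) \<Rightarrow> ('w \<Rightarrow>\<^sub>0 'k) \<Rightarrow> 'a" where
  "lin_ext val f = (\<Sum>w\<in>Poly_Mapping.keys f. sc (Poly_Mapping.lookup f w) * val w)"

lemma lin_ext_superset:
  assumes "finite S" and "Poly_Mapping.keys f \<subseteq> S"
  shows "lin_ext val f = (\<Sum>w\<in>S. sc (Poly_Mapping.lookup f w) * val w)"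
  unfolding lin_ext_def using assms
  by (intro sum.mono_neutral_left) (auto simp: in_keys_iff sc_zero)

lemma lin_ext_zero [simp]: "lin_ext val 0 = 0"
  by (simp add: lin_ext_def)

lemma lin_ext_single [simp]: "lin_ext val (Poly_Mapping.single w c) = sc c * val w"
  by (simp add: lin_ext_def sc_zero)

lemma lin_ext_add [simp]: "lin_ext val (f + g) = lin_ext val f + lin_ext val g"
proof -
  let ?S = "Poly_Mapping.keys f \<union> Poly_Mapping.keys g"
  have "lin_ext val h = (\<Sum>w\<in>?S. sc (Poly_Mapping.lookup h w) * val w)"
    if "Poly_Mapping.keys h \<subseteq> ?S" for h
    using that by (intro lin_ext_superset) auto
  then show ?thesis
    using Poly_Mapping.keys_add[of f g]
    by (simp add: lookup_add sc_add distrib_right sum.distrib)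
qed

lemma lin_ext_sum [simp]: "lin_ext val (\<Sum>i\<in>I. f i) = (\<Sum>i\<in>I. lin_ext val (f i))"
  by (induction I rule: infinite_finite_induct) simp_all

lemma lin_ext_diff [simp]: "lin_ext val (f - g) = lin_ext val f - lin_ext val g"
  using lin_ext_add[of val "f - g" g] by (simp add: algebra_simps)

lemma lin_ext_uminus [simp]: "lin_ext val (- g) = - lin_ext val g"
  using lin_ext_diff[of val 0 g] by simp

lemma lin_ext_scale [simp]: "lin_ext val (Poly_Mapping.map ((*) c) f) = sc c * lin_ext val f"
proof -
  have "Poly_Mapping.lookup (Poly_Mapping.map ((*) c) f) w = c * Poly_Mapping.lookup f w" for w
    by (simp add: Poly_Mapping.map.rep_eq when_def)
  moreover from this have "Poly_Mapping.keys (Poly_Mapping.map ((*) c) f) \<subseteq> Poly_Mapping.keys f"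
    by (auto simp: in_keys_iff)
  ultimately show ?thesis
    by (subst lin_ext_superset[of "Poly_Mapping.keys f"])
      (simp_all add: lin_ext_def sc_mult mult.assoc sum_distrib_left)
qed

definition free_eval :: "('x \<Rightarrow> 'a) \<Rightarrow> ('x free_monoid \<Rightarrow>\<^sub>0 'k) \<Rightarrow> 'a" where
  "free_eval g = lin_ext (\<lambda>w. prod_list (map g (letters w)))"

lemma free_eval_simps [simp]:
  "free_eval g 0 = 0"
  "free_eval g (p + q) = free_eval g p + free_eval g q"
  "free_eval g (p - q) = free_eval g p - free_eval g q"
  "free_eval g (Poly_Mapping.map ((*) c) p) = sc c * free_eval g p"
  "free_eval g (free_const c) = sc c"
  "free_eval g (free_gen x) = g x"
  "free_eval g 1 = 1"
  by (simp_all add: free_eval_def free_gen_def zero_free_monoid_def sc_one flip: single_one)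

lemma free_eval_mult [simp]: "free_eval g (p * q) = free_eval g p * free_eval g q"
  using subset_UNIV
proof (induction p rule: poly_mapping_additive_induct)
  case (single v c)
  show ?case
    using subset_UNIV
  proof (induction q rule: poly_mapping_additive_induct)
    case (single w d)
    then show ?case
      by (simp add: free_eval_def mult_single plus_free_monoid_def sc_mult mult.assoc
            sc_central_left[of "prod_list (map g (letters v))"])
  qed (simp_all add: distrib_left)
qed (simp_all add: distrib_right)

end

lemma free_algebra_induct [case_names const gen add mult]:
  fixes p :: "'x free_monoid \<Rightarrow>\<^sub>0 'k::field"
  assumes const: "\<And>c. P (free_const c)"
    and gen: "\<And>x. P (free_gen x)"
    and add: "\<And>p q. P p \<Longrightarrow> P q \<Longrightarrow> P (p + q)"
    and mult: "\<And>p q. P p \<Longrightarrow> P q \<Longrightarrow> P (p * q)"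
  shows "P p"
  using subset_UNIV
proof (induction p rule: poly_mapping_additive_induct)
  case zero
  show ?case using const[of 0] by simp
next
  case (single w c)
  have "P (Poly_Mapping.single (Word l) c)" for l
  proof (induction l)
    case Nil
    show ?case using const[of c] by (simp add: zero_free_monoid_def)
  next
    case (Cons x l)
    have "Poly_Mapping.single (Word (x # l)) c = free_gen x * Poly_Mapping.single (Word l) c"
      by (simp add: free_gen_def mult_single plus_free_monoid_def)
    then show ?case using Cons gen mult by simp
  qed
  then show ?case by (cases w) simp
qed (blast intro: add)

section \<open>Path algebras\<close>

text \<open>Cancellation can make the keys of a sum smaller than those of its summands; bilinearity
  is proved over common index sets, on which extra terms vanish.\<close>

lemma path_mult_superset:
  assumes "finite S" "Poly_Mapping.keys f \<subseteq> S" "finite T" "Poly_Mapping.keys g \<subseteq> T"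
  shows "f \<star> g = (\<Sum>(s, p, t)\<in>S. \<Sum>(s', p', t')\<in>T.
      if t = s'
      then Poly_Mapping.single (s, p @ p', t')
             (Poly_Mapping.lookup f (s, p, t) * Poly_Mapping.lookup g (s', p', t'))
      else 0)"
proof -
  have "f \<star> g = (\<Sum>(s, p, t)\<in>S. \<Sum>(s', p', t')\<in>Poly_Mapping.keys g.
      if t = s'
      then Poly_Mapping.single (s, p @ p', t')
             (Poly_Mapping.lookup f (s, p, t) * Poly_Mapping.lookup g (s', p', t'))
      else 0)"
    unfolding path_mult_def using assms
    by (intro sum.mono_neutral_left) (auto simp: in_keys_iff intro!: sum.neutral)
  also have "\<dots> = (\<Sum>(s, p, t)\<in>S. \<Sum>(s', p', t')\<in>T.
      if t = s'
      then Poly_Mapping.single (s, p @ p', t')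
             (Poly_Mapping.lookup f (s, p, t) * Poly_Mapping.lookup g (s', p', t'))
      else 0)"
    using assms by (intro sum.cong refl, clarify, intro sum.mono_neutral_left) (auto simp: in_keys_iff)
  finally show ?thesis .
qed

lemma path_mult_single [simp]:
  "Poly_Mapping.single (s, p, t) c \<star> Poly_Mapping.single (s', p', t') d =
    (if t = s' then Poly_Mapping.single (s, p @ p', t') (c * d) else 0)"
  by (subst path_mult_superset[of "{(s, p, t)}" _ "{(s', p', t')}"]) auto

lemma path_mult_distrib_right: "(f + g) \<star> h = f \<star> h + g \<star> h"
proof -
  let ?S = "Poly_Mapping.keys f \<union> Poly_Mapping.keys g" and ?T = "Poly_Mapping.keys h"
  have "k \<star> h = (\<Sum>(s, p, t)\<in>?S. \<Sum>(s', p', t')\<in>?T.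
      if t = s'
      then Poly_Mapping.single (s, p @ p', t')
             (Poly_Mapping.lookup k (s, p, t) * Poly_Mapping.lookup h (s', p', t'))
      else 0)" if "Poly_Mapping.keys k \<subseteq> ?S" for k
    using that by (intro path_mult_superset) auto
  then show ?thesis
    using Poly_Mapping.keys_add[of f g]
    by (auto simp: lookup_add distrib_right single_add simp flip: sum.distrib intro!: sum.cong)
qed

lemma path_mult_distrib_left: "h \<star> (f + g) = h \<star> f + h \<star> g"
proof -
  let ?S = "Poly_Mapping.keys f \<union> Poly_Mapping.keys g" and ?T = "Poly_Mapping.keys h"
  have "h \<star> k = (\<Sum>(s, p, t)\<in>?T. \<Sum>(s', p', t')\<in>?S.
      if t = s'
      then Poly_Mapping.single (s, p @ p', t')
             (Poly_Mapping.lookup h (s, p, t) * Poly_Mapping.lookup k (s', p', t'))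
      else 0)" if "Poly_Mapping.keys k \<subseteq> ?S" for k
    using that by (intro path_mult_superset) auto
  then show ?thesis
    using Poly_Mapping.keys_add[of f g]
    by (auto simp: lookup_add distrib_left single_add simp flip: sum.distrib intro!: sum.cong)
qed

lemma path_mult_zero [simp]: "0 \<star> f = 0" "f \<star> 0 = 0"
  by (simp_all add: path_mult_def)

lemma path_mult_assoc: "f \<star> g \<star> h = f \<star> (g \<star> h)"
  using subset_UNIV
proof (induction f rule: poly_mapping_additive_induct)
  case (single x c)
  show ?case
    using subset_UNIV
  proof (induction g rule: poly_mapping_additive_induct)
    case (single y d)
    show ?case
      using subset_UNIV
    proof (induction h rule: poly_mapping_additive_induct)
      case (single z e)
      show ?case
        by (cases x; cases y; cases z) (simp add: mult.assoc)
    qed (simp_all add: path_mult_distrib_left)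
  qed (simp_all add: path_mult_distrib_left path_mult_distrib_right)
qed (simp_all add: path_mult_distrib_right)

section \<open>Quotients of algebras\<close>

locale unital_algebra = ring A for A :: "('k::field, 'a) module" (structure) +
  assumes smult_closed [simp]: "x \<in> carrier A \<Longrightarrow> k \<odot> x \<in> carrier A"
    and smult_add_left: "x \<in> carrier A \<Longrightarrow> (k + l) \<odot> x = k \<odot> x \<oplus> l \<odot> x"
    and smult_add_right: "x \<in> carrier A \<Longrightarrow> y \<in> carrier A \<Longrightarrow> k \<odot> (x \<oplus> y) = k \<odot> x \<oplus> k \<odot> y"
    and smult_mult: "x \<in> carrier A \<Longrightarrow> (k * l) \<odot> x = k \<odot> (l \<odot> x)"
    and smult_one: "x \<in> carrier A \<Longrightarrow> 1 \<odot> x = x"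
    and smult_assoc_left: "x \<in> carrier A \<Longrightarrow> y \<in> carrier A \<Longrightarrow> (k \<odot> x) \<otimes> y = k \<odot> (x \<otimes> y)"
    and smult_assoc_right: "x \<in> carrier A \<Longrightarrow> y \<in> carrier A \<Longrightarrow> x \<otimes> (k \<odot> y) = k \<odot> (x \<otimes> y)"

text \<open>The two records have different types, but being a ring depends only on the carrier and
  the ring operations, which agree.\<close>

lemma ring_quot_algebra_iff: "ring (quot_algebra A I) \<longleftrightarrow> ring (A Quot I)"
  unfolding ring_def ring_axioms_def abelian_group_def abelian_monoid_def abelian_group_axioms_def
    monoid_def comm_group_def group_def group_axioms_def comm_monoid_def comm_monoid_axioms_def Units_def
  by (simp add: quot_algebra_def)

locale algebra_ideal = unital_algebra A for A (structure) and I +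
  assumes ideal: "ideal I A"
begin

interpretation ideal I A
  by (rule ideal)

abbreviation coset where "coset x \<equiv> I +> x"

lemma coset_surj: "carrier (quot_algebra A I) = coset ` carrier A"
  by (auto simp: quot_algebra_def FactRing_def A_RCOSETS_def' )

lemma coset_closed [simp]: "x \<in> carrier A \<Longrightarrow> coset x \<in> carrier (quot_algebra A I)"
  by (simp add: coset_surj)

lemma ring_quot: "ring (quot_algebra A I)"
  unfolding ring_quot_algebra_iff by (rule quotient_is_ring)

lemma coset_hom: "coset \<in> ring_hom A (quot_algebra A I)"
  using rcos_ring_hom by (simp add: quot_algebra_def ring_hom_def)

lemma coset_eq_iff:
  assumes "x \<in> carrier A" "y \<in> carrier A"
  shows "coset x = coset y \<longleftrightarrow> x \<ominus> y \<in> I"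
  using quotient_eq_iff_same_a_r_cos[OF ideal assms] by simp

lemma coset_eq_zero_iff:
  assumes "x \<in> carrier A"
  shows "coset x = \<zero>\<^bsub>quot_algebra A I\<^esub> \<longleftrightarrow> x \<in> I"
proof -
  have "\<zero>\<^bsub>quot_algebra A I\<^esub> = coset \<zero>"
    using coset_hom ring_quot by (metis ring_hom_zero ring_axioms)
  then show ?thesis
    using coset_eq_iff[of x \<zero>] assms by (simp add: minus_eq)
qed

text \<open>The scalar action on cosets is a union over representatives. It collapses to one coset
  because \<open>k \<odot> i = (k \<odot> \<one>) \<otimes> i\<close> stays in the ideal.\<close>

lemma coset_smult:
  assumes x: "x \<in> carrier A"
  shows "k \<odot>\<^bsub>quot_algebra A I\<^esub> coset x = coset (k \<odot> x)"
proof -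
  have "coset (k \<odot> y) = coset (k \<odot> x)" if "y \<in> coset x" for y
  proof -
    obtain i where i: "i \<in> I" "y = i \<oplus> x"
      using \<open>y \<in> coset x\<close> by (auto simp: a_r_coset_def')
    then have ic: "i \<in> carrier A" by simp
    have "k \<odot> i = (k \<odot> \<one>) \<otimes> i"
      using ic smult_assoc_left[of \<one> i k] by simp
    then have "k \<odot> i \<in> I"
      using i I_l_closed by simp
    moreover have "k \<odot> y \<ominus> k \<odot> x = k \<odot> i"
      using i ic x by (simp add: smult_add_right minus_eq a_assoc r_neg)
    ultimately show ?thesis
      using coset_eq_iff[of "k \<odot> y" "k \<odot> x"] i ic x by simp
  qed
  moreover have "x \<in> coset x"
    using a_rcos_self[OF x] .
  ultimately have "(\<Union>y\<in>coset x. coset (k \<odot> y)) = coset (k \<odot> x)"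
    by blast
  then show ?thesis
    by (simp add: quot_algebra_def)
qed

lemma quotient_unital_algebra: "unital_algebra (quot_algebra A I)"
proof -
  interpret h: ring_hom_ring A "quot_algebra A I" coset
    by (rule ring_hom_ringI2[OF ring_axioms ring_quot coset_hom])
  show ?thesis
    by (intro unital_algebra.intro ring_quot unital_algebra_axioms.intro)
      (auto simp: coset_surj coset_smult smult_add_left smult_add_right smult_mult smult_one
        smult_assoc_left smult_assoc_right simp flip: h.hom_mult h.hom_add)
qed

lemma coset_hom_ring: "ring_hom_ring A (quot_algebra A I) coset"
  by (rule ring_hom_ringI2[OF ring_axioms ring_quot coset_hom])

end

lemma (in unital_algebra) presented_algebra_ideal:
  assumes "R \<subseteq> carrier A"
  shows "algebra_ideal A (Idl R)"
  using assms by (intro algebra_ideal.intro unital_algebra_axioms algebra_ideal_axioms.intro genideal_ideal)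

lemma (in ring_hom_ring) vanishes_on_genideal:
  assumes "X \<subseteq> carrier R" and "\<And>x. x \<in> X \<Longrightarrow> h x = \<zero>\<^bsub>S\<^esub>" and "x \<in> Idl X"
  shows "h x = \<zero>\<^bsub>S\<^esub>"
proof -
  have "X \<subseteq> a_kernel R S h"
    unfolding a_kernel_def' using assms(1,2) by blast
  then have "Idl X \<subseteq> a_kernel R S h"
    by (rule R.genideal_minimal[OF kernel_is_ideal])
  then show ?thesis
    using assms(3) kernel_zero by blast
qed

text \<open>Reads a ring type with scalars back as a record, so that kernels and generated ideals
  become available for maps into the type.\<close>

definition type_algebra :: "('k \<Rightarrow> 'a::ring_1) \<Rightarrow> ('k, 'a) module" where
  "type_algebra sc = \<lparr>carrier = UNIV, monoid.mult = (*), one = 1, ring.zero = 0, add = (+),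
     module.smult = (\<lambda>k x. sc k * x)\<rparr>"

lemma type_algebra_simps [simp]:
  "carrier (type_algebra sc) = UNIV"
  "x \<otimes>\<^bsub>type_algebra sc\<^esub> y = x * y"
  "x \<oplus>\<^bsub>type_algebra sc\<^esub> y = x + y"
  "\<one>\<^bsub>type_algebra sc\<^esub> = 1"
  "\<zero>\<^bsub>type_algebra sc\<^esub> = 0"
  "k \<odot>\<^bsub>type_algebra sc\<^esub> x = sc k * x"
  by (simp_all add: type_algebra_def)

lemma ring_type_algebra: "ring (type_algebra sc)"
proof (rule ringI)
  show "abelian_group (type_algebra sc)"
    by (rule abelian_groupI) (auto simp: algebra_simps intro: add.right_inverse)
  show "monoid (type_algebra sc)"
    by (rule monoidI) (auto simp: algebra_simps)
qed (auto simp: algebra_simps)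

lemma (in central_scalars) unital_algebra_type_algebra: "unital_algebra (type_algebra sc)"
  by (intro unital_algebra.intro ring_type_algebra unital_algebra_axioms.intro)
    (auto simp: sc_add sc_mult sc_one algebra_simps intro: sc_central_left)

lemma free_algebra_eq: "free_algebra = type_algebra free_const"
  by (simp add: free_algebra_def type_algebra_def mult_map_scale_conv_mult fun_eq_iff)

lemma central_scalars_free_const: "central_scalars free_const"
proof
  show "r * free_const k = free_const k * r" for k and r :: "'x free_monoid \<Rightarrow>\<^sub>0 'k::field"
    using subset_UNIV
    by (induction r rule: poly_mapping_additive_induct)
      (simp_all add: mult_single mult.commute distrib_left distrib_right)
qed (simp_all add: single_add mult_single flip: single_one)

lemma unital_algebra_free_algebra: "unital_algebra free_algebra"
  unfolding free_algebra_eq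
  by (rule central_scalars.unital_algebra_type_algebra[OF central_scalars_free_const])

lemma free_algebra_simps [simp]:
  "carrier free_algebra = UNIV"
  "x \<otimes>\<^bsub>free_algebra\<^esub> y = x * y"
  "x \<oplus>\<^bsub>free_algebra\<^esub> y = x + y"
  "\<one>\<^bsub>free_algebra\<^esub> = 1"
  "\<zero>\<^bsub>free_algebra\<^esub> = 0"
  "k \<odot>\<^bsub>free_algebra\<^esub> x = Poly_Mapping.map ((*) k) x"
  by (simp_all add: free_algebra_def)

lemma (in central_scalars) free_eval_hom:
  "ring_hom_ring free_algebra (type_algebra sc) (free_eval g)"
  using unital_algebra_free_algebra
  by (intro ring_hom_ringI ring_type_algebra) (auto simp: unital_algebra_def)

lemma path_mult_sum_left: "(\<Sum>i\<in>I. f i) \<star> g = (\<Sum>i\<in>I. f i \<star> g)"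
  by (induction I rule: infinite_finite_induct) (simp_all add: path_mult_distrib_right)

lemma path_mult_sum_right: "g \<star> (\<Sum>i\<in>I. f i) = (\<Sum>i\<in>I. g \<star> f i)"
  by (induction I rule: infinite_finite_induct) (simp_all add: path_mult_distrib_left)

lemma path_algebra_simps [simp]:
  "f \<in> carrier (path_algebra Q) \<longleftrightarrow> Poly_Mapping.keys f \<subseteq> paths Q"
  "f \<otimes>\<^bsub>path_algebra Q\<^esub> g = f \<star> g"
  "f \<oplus>\<^bsub>path_algebra Q\<^esub> g = f + g"
  "\<one>\<^bsub>path_algebra Q\<^esub> = (\<Sum>v\<in>verts Q. Poly_Mapping.single (v, [], v) 1)"
  "\<zero>\<^bsub>path_algebra Q\<^esub> = 0"
  "k \<odot>\<^bsub>path_algebra Q\<^esub> f = Poly_Mapping.map ((*) k) f"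
  by (simp_all add: path_algebra_def)

lemma lookup_map_scale [simp]:
  "Poly_Mapping.lookup (Poly_Mapping.map ((*) k) f) x = k * Poly_Mapping.lookup f x"
  for k :: "'k::field"
  by (simp add: Poly_Mapping.map.rep_eq when_def)

lemma keys_map_subset: "Poly_Mapping.keys (Poly_Mapping.map ((*) k) f) \<subseteq> Poly_Mapping.keys f"
  for k :: "'k::field"
  by (auto simp: in_keys_iff)

lemma map_scale_zero [simp]: "Poly_Mapping.map ((*) k) 0 = 0"
  for k :: "'k::field"
  by (rule poly_mapping_eqI) simp

lemma map_scale_add:
  "Poly_Mapping.map ((*) k) (f + g) = Poly_Mapping.map ((*) k) f + Poly_Mapping.map ((*) k) g"
  for k :: "'k::field"
  by (rule poly_mapping_eqI) (simp add: lookup_add distrib_left)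

lemma map_scale_add_left:
  "Poly_Mapping.map ((*) (k + l)) f = Poly_Mapping.map ((*) k) f + Poly_Mapping.map ((*) l) f"
  for k l :: "'k::field"
  by (rule poly_mapping_eqI) (simp add: lookup_add distrib_right)

lemma map_scale_mult:
  "Poly_Mapping.map ((*) (k * l)) f = Poly_Mapping.map ((*) k) (Poly_Mapping.map ((*) l) f)"
  for k l :: "'k::field"
  by (rule poly_mapping_eqI) simp

lemma map_scale_one: "Poly_Mapping.map ((*) 1) f = f"
  for f :: "'a \<Rightarrow>\<^sub>0 'k::field"
  by (rule poly_mapping_eqI) simp

lemma path_mult_scale:
  "Poly_Mapping.map ((*) k) f \<star> g = Poly_Mapping.map ((*) k) (f \<star> g)"
  "f \<star> Poly_Mapping.map ((*) k) g = Poly_Mapping.map ((*) k) (f \<star> g)"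
proof -
  have "Poly_Mapping.map ((*) k) f \<star> g = Poly_Mapping.map ((*) k) (f \<star> g) \<and>
    f \<star> Poly_Mapping.map ((*) k) g = Poly_Mapping.map ((*) k) (f \<star> g)"
    using subset_UNIV
  proof (induction f rule: poly_mapping_additive_induct)
    case (single x c)
    show ?case
      using subset_UNIV
    proof (induction g rule: poly_mapping_additive_induct)
      case (single y d)
      show ?case
        by (cases x; cases y) (simp add: mult.assoc mult.left_commute[of _ k])
    qed (simp_all add: path_mult_distrib_left map_scale_add)
  qed (simp_all add: path_mult_distrib_right map_scale_add)
  then show "Poly_Mapping.map ((*) k) f \<star> g = Poly_Mapping.map ((*) k) (f \<star> g)"
    "f \<star> Poly_Mapping.map ((*) k) g = Poly_Mapping.map ((*) k) (f \<star> g)"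
    by blast+
qed

section \<open>Path algebras with a unit and their evaluation in a ring\<close>

locale vertex_finite_digraph = wf_digraph Q for Q :: "('v, 'e) pre_digraph" +
  assumes finite_verts: "finite (verts Q)"
begin

lemma paths_append:
  assumes "(s, p, t) \<in> paths Q" "(t, p', t') \<in> paths Q"
  shows "(s, p @ p', t') \<in> paths Q"
  using assms by (auto simp: paths_def awalk_def)

lemma paths_verts:
  assumes "(s, p, t) \<in> paths Q"
  shows "s \<in> verts Q" "t \<in> verts Q"
  using assms by (auto simp: paths_def)

lemma path_mult_closed:
  assumes "Poly_Mapping.keys f \<subseteq> paths Q" "Poly_Mapping.keys g \<subseteq> paths Q"
  shows "Poly_Mapping.keys (f \<star> g) \<subseteq> paths Q"
  using assms(1)
proof (induction f rule: poly_mapping_additive_induct)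
  case (single x c)
  note x = single
  from assms(2) show ?case
  proof (induction g rule: poly_mapping_additive_induct)
    case (single y d)
    with x show ?case
      by (cases x; cases y) (auto intro: paths_append)
  qed (simp_all add: path_mult_distrib_left order.trans[OF Poly_Mapping.keys_add])
qed (simp_all add: path_mult_distrib_right order.trans[OF Poly_Mapping.keys_add])

lemma path_mult_one:
  assumes "Poly_Mapping.keys f \<subseteq> paths Q"
  shows "(\<Sum>v\<in>verts Q. Poly_Mapping.single (v, [], v) 1) \<star> f = f"
    and "f \<star> (\<Sum>v\<in>verts Q. Poly_Mapping.single (v, [], v) 1) = f"
proof -
  let ?e = "\<Sum>v\<in>verts Q. Poly_Mapping.single (v, [], v) 1"
  from assms have "?e \<star> f = f \<and> f \<star> ?e = f"
  proof (induction f rule: poly_mapping_additive_induct)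
    case (single x c)
    obtain s p t where x: "x = (s, p, t)" by (cases x)
    then show ?case
      using single paths_verts[of s p t] finite_verts
      by (simp add: path_mult_sum_left path_mult_sum_right)
  qed (simp_all add: path_mult_distrib_left path_mult_distrib_right)
  then show "?e \<star> f = f" "f \<star> ?e = f" by blast+
qed

lemma vertex_path: "v \<in> verts Q \<Longrightarrow> (v, [], v) \<in> paths Q"
  by (simp add: paths_def awalk_def)

lemma arrow_path: "a \<in> arcs Q \<Longrightarrow> (tail Q a, [a], head Q a) \<in> paths Q"
  by (simp add: paths_def awalk_def)

lemma ring_path_algebra: "ring (path_algebra Q :: ('k::field, _) module)"
proof (rule ringI)
  show "abelian_group (path_algebra Q :: ('k, _) module)"
  proof (rule abelian_groupI)
    fix x y :: "('v, 'e) path \<Rightarrow>\<^sub>0 'k"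
    assume "x \<in> carrier (path_algebra Q)" "y \<in> carrier (path_algebra Q)"
    then show "x \<oplus>\<^bsub>path_algebra Q\<^esub> y \<in> carrier (path_algebra Q)"
      by (simp add: order.trans[OF Poly_Mapping.keys_add])
  next
    fix x :: "('v, 'e) path \<Rightarrow>\<^sub>0 'k"
    assume "x \<in> carrier (path_algebra Q)"
    then show "\<exists>y\<in>carrier (path_algebra Q). y \<oplus>\<^bsub>path_algebra Q\<^esub> x = \<zero>\<^bsub>path_algebra Q\<^esub>"
      by (intro bexI[of _ "- x"]) (auto simp: in_keys_iff)
  qed (simp_all add: add_ac)
  show "Group.monoid (path_algebra Q :: ('k, _) module)"
  proof (rule monoidI)
    show "\<one>\<^bsub>path_algebra Q\<^esub> \<in> carrier (path_algebra Q :: ('k, _) module)"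
      using Poly_Mapping.keys_sum[of "\<lambda>v. Poly_Mapping.single (v, [], v) (1 :: 'k)" "verts Q"]
      by (auto simp: vertex_path)
  qed (simp_all add: path_mult_closed path_mult_assoc path_mult_one)
qed (simp_all add: path_mult_distrib_left path_mult_distrib_right)

lemma unital_algebra_path_algebra: "unital_algebra (path_algebra Q :: ('k::field, _) module)"
  by (intro unital_algebra.intro ring_path_algebra unital_algebra_axioms.intro)
    (simp_all add: order.trans[OF keys_map_subset] map_scale_add map_scale_add_left map_scale_mult
      map_scale_one path_mult_scale)

end

text \<open>The data of a homomorphism from the path algebra: a complete system of orthogonal
  idempotents for the vertices and, for each arrow, an element of the corner cut out by its tail and
  head.\<close>

locale path_rep = central_scalars sc + vertex_finite_digraph Q
  for sc :: "'k::field \<Rightarrow> 'a::ring_1" and Q :: "('v, 'e) pre_digraph" +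
  fixes e :: "'v \<Rightarrow> 'a" and g :: "'e \<Rightarrow> 'a"
  assumes e_mult: "s \<in> verts Q \<Longrightarrow> t \<in> verts Q \<Longrightarrow> e s * e t = (if s = t then e s else 0)"
    and e_sum: "(\<Sum>v\<in>verts Q. e v) = 1"
    and g_source: "a \<in> arcs Q \<Longrightarrow> e (tail Q a) * g a = g a"
    and g_target: "a \<in> arcs Q \<Longrightarrow> g a * e (head Q a) = g a"
begin

text \<open>The factor \<^term>\<open>e t\<close> may be omitted: see \<open>path_val_target\<close>.\<close>

fun path_val :: "('v, 'e) path \<Rightarrow> 'a" where
  "path_val (s, p, t) = e s * prod_list (map g p)"

definition path_eval :: "(('v, 'e) path \<Rightarrow>\<^sub>0 'k) \<Rightarrow> 'a" where
  "path_eval = lin_ext path_val"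

lemma path_val_target:
  assumes "(s, p, t) \<in> paths Q"
  shows "e s * prod_list (map g p) * e t = e s * prod_list (map g p)"
proof -
  have "s \<in> verts Q" "t \<in> verts Q" "set p \<subseteq> arcs Q" "cas s p t"
    using assms paths_verts[OF assms] by (simp_all add: paths_def awalk_def)
  then show ?thesis
  proof (induction p arbitrary: s)
    case Nil
    then show ?case by (simp add: e_mult)
  next
    case (Cons a p)
    \<comment> \<open>The idempotent at the head of \<open>a\<close> is inserted so that the
      induction hypothesis for the rest of the path applies.\<close>
    have 1: "g a * (e (head Q a) * r) = g a * r" for r
      using Cons.prems g_target[of a] by (simp flip: mult.assoc)
    have "e (head Q a) * prod_list (map g p) * e t = e (head Q a) * prod_list (map g p)"
      using Cons by simp
    then have "g a * (prod_list (map g p) * e t) = g a * prod_list (map g p)"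
      by (metis 1 mult.assoc)
    then show ?case by (simp add: mult.assoc)
  qed
qed

lemma path_val_mult:
  assumes "(s, p, t) \<in> paths Q" "(s', p', t') \<in> paths Q"
  shows "path_val (s, p, t) * path_val (s', p', t') = (if t = s' then path_val (s, p @ p', t') else 0)"
proof -
  have "path_val (s, p, t) * path_val (s', p', t') =
      e s * prod_list (map g p) * (e t * e s') * prod_list (map g p')"
    using path_val_target[OF assms(1)] by (simp flip: mult.assoc)
  also have "\<dots> = (if t = s' then e s * prod_list (map g p) * e t * prod_list (map g p') else 0)"
    using e_mult[of t s'] paths_verts assms by (simp add: mult.assoc)
  also have "\<dots> = (if t = s' then path_val (s, p @ p', t') else 0)"
    unfolding path_val_target[OF assms(1)] by (simp add: mult.assoc)
  finally show ?thesis .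
qed

lemma path_eval_mult:
  assumes "Poly_Mapping.keys f \<subseteq> paths Q" "Poly_Mapping.keys h \<subseteq> paths Q"
  shows "path_eval (f \<star> h) = path_eval f * path_eval h"
  using assms(1)
proof (induction f rule: poly_mapping_additive_induct)
  case (single x c)
  note x = single
  from assms(2) show ?case
  proof (induction h rule: poly_mapping_additive_induct)
    case (single y d)
    obtain s p t s' p' t' where xy: "x = (s, p, t)" "y = (s', p', t')"
      by (cases x; cases y)
    have "path_eval (Poly_Mapping.single x c) * path_eval (Poly_Mapping.single y d) =
        sc (c * d) * (path_val x * path_val y)"
      unfolding path_eval_def lin_ext_single sc_mult
      by (simp add: mult.assoc sc_central_left[of "path_val x" d])
    also have "\<dots> = path_eval (Poly_Mapping.single x c \<star> Poly_Mapping.single y d)"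
      unfolding xy using x single
      by (subst path_val_mult) (simp_all add: xy path_eval_def del: path_val.simps)
    finally show ?case ..
  qed (simp_all add: path_mult_distrib_left distrib_left path_eval_def)
qed (simp_all add: path_mult_distrib_right distrib_right path_eval_def)

lemma path_eval_simps [simp]:
  "path_eval 0 = 0"
  "path_eval (f + h) = path_eval f + path_eval h"
  "path_eval (f - h) = path_eval f - path_eval h"
  "path_eval (- f) = - path_eval f"
  "path_eval (Poly_Mapping.map ((*) c) f) = sc c * path_eval f"
  "path_eval (Poly_Mapping.single (v, [], v) c) = sc c * e v"
  by (simp_all add: path_eval_def)

lemma path_eval_arrow [simp]: "a \<in> arcs Q \<Longrightarrow> path_eval (path_arrow Q a) = g a"
  by (simp add: path_eval_def path_arrow_def sc_one g_source)

lemma path_eval_one: "path_eval (\<Sum>v\<in>verts Q. Poly_Mapping.single (v, [], v) 1) = 1"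
  by (simp add: path_eval_def sc_one e_sum)

lemma path_eval_hom: "ring_hom_ring (path_algebra Q) (type_algebra sc) path_eval"
  by (intro ring_hom_ringI ring_path_algebra ring_type_algebra)
    (simp_all add: path_eval_mult path_eval_one)

end

lemma (in vertex_finite_digraph) path_algebra_induct [consumes 1, case_names vertex arrow add mult scale zero]:
  fixes f :: "('v, 'e) path \<Rightarrow>\<^sub>0 'k::field"
  assumes "f \<in> carrier (path_algebra Q)"
    and vertex: "\<And>v. v \<in> verts Q \<Longrightarrow> P (Poly_Mapping.single (v, [], v) 1)"
    and arrow: "\<And>a. a \<in> arcs Q \<Longrightarrow> P (path_arrow Q a)"
    and add: "\<And>f g. f \<in> carrier (path_algebra Q) \<Longrightarrow> g \<in> carrier (path_algebra Q) \<Longrightarrow>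
      P f \<Longrightarrow> P g \<Longrightarrow> P (f + g)"
    and mult: "\<And>f g. f \<in> carrier (path_algebra Q) \<Longrightarrow> g \<in> carrier (path_algebra Q) \<Longrightarrow>
      P f \<Longrightarrow> P g \<Longrightarrow> P (f \<star> g)"
    and scale: "\<And>k f. f \<in> carrier (path_algebra Q) \<Longrightarrow> P f \<Longrightarrow> P (Poly_Mapping.map ((*) k) f)"
    and zero: "P 0"
  shows "P f"
  using assms(1) unfolding path_algebra_simps
proof (induction f rule: poly_mapping_additive_induct)
  case (single x c)
  obtain s p t where x: "x = (s, p, t)" by (cases x)
  have "s \<in> verts Q" "set p \<subseteq> arcs Q" "cas s p t"
    using single by (auto simp: x paths_def awalk_def)
  then have "P (Poly_Mapping.single (s, p, t) 1)"
  proof (induction p arbitrary: s)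
    case Nil
    then show ?case by (simp add: vertex)
  next
    case (Cons a p)
    then have path: "(head Q a, p, t) \<in> paths Q" and a: "a \<in> arcs Q" "tail Q a = s"
      by (auto simp: paths_def awalk_def)
    have "P (path_arrow Q a \<star> Poly_Mapping.single (head Q a, p, t) 1)"
      using Cons path a arrow_path[of a] by (intro mult arrow) (auto simp: path_arrow_def)
    then show ?case by (simp add: path_arrow_def a)
  qed
  then have "P (Poly_Mapping.map ((*) c) (Poly_Mapping.single (s, p, t) 1))"
    using single by (intro scale) (auto simp: x)
  then show ?case by (simp add: x)
qed (use add zero in auto)

section \<open>Quotients as types\<close>

text \<open>Here the class operations of \<open>'t\<close> mirror those of the quotient. Through
  \<open>cls\<close>, membership in \<open>I\<close> becomes an equation \<open>cls x = 0\<close> in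
  a ring type.\<close>

locale typed_quotient = algebra_ideal A I
  for A :: "('k::field, 'a) module" (structure) and I +
  fixes Rep :: "'t::ring_1 \<Rightarrow> 'a set" and Abs
  assumes type_def: "type_definition Rep Abs (carrier (quot_algebra A I))"
    and Rep_add: "Rep (s + t) = Rep s \<oplus>\<^bsub>quot_algebra A I\<^esub> Rep t"
    and Rep_mult: "Rep (s * t) = Rep s \<otimes>\<^bsub>quot_algebra A I\<^esub> Rep t"
    and Rep_one: "Rep 1 = \<one>\<^bsub>quot_algebra A I\<^esub>"
    and Rep_zero: "Rep 0 = \<zero>\<^bsub>quot_algebra A I\<^esub>"
begin

definition cls :: "'a \<Rightarrow> 't" where "cls x = Abs (coset x)"
definition sc :: "'k \<Rightarrow> 't" where "sc k = cls (k \<odot> \<one>)"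

interpretation td: type_definition Rep Abs "carrier (quot_algebra A I)"
  by (rule type_def)

interpretation h: ring_hom_ring A "quot_algebra A I" coset
  by (rule coset_hom_ring)

lemma Rep_cls [simp]: "x \<in> carrier A \<Longrightarrow> Rep (cls x) = coset x"
  by (simp add: cls_def td.Abs_inverse)

lemma cls_surj: obtains x where "x \<in> carrier A" "t = cls x"
proof -
  have "Rep t \<in> coset ` carrier A"
    using td.Rep[of t] by (simp add: coset_surj)
  then show ?thesis
    using that by (auto simp: cls_def) (metis td.Rep_inverse)
qed

lemma cls_add: "x \<in> carrier A \<Longrightarrow> y \<in> carrier A \<Longrightarrow> cls (x \<oplus> y) = cls x + cls y"
  by (subst td.Rep_inject[symmetric]) (simp add: Rep_add)

lemma cls_mult: "x \<in> carrier A \<Longrightarrow> y \<in> carrier A \<Longrightarrow> cls (x \<otimes> y) = cls x * cls y"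
  by (subst td.Rep_inject[symmetric]) (simp add: Rep_mult)

lemma cls_one: "cls \<one> = 1"
  by (subst td.Rep_inject[symmetric]) (simp add: Rep_one)

lemma cls_smult: "x \<in> carrier A \<Longrightarrow> cls (k \<odot> x) = sc k * cls x"
  using cls_mult[of "k \<odot> \<one>" x] by (simp add: sc_def smult_assoc_left)

lemma cls_eq_zero_iff: "x \<in> carrier A \<Longrightarrow> cls x = 0 \<longleftrightarrow> x \<in> I"
  by (subst td.Rep_inject[symmetric]) (simp add: Rep_zero coset_eq_zero_iff)

sublocale central_scalars sc
proof
  fix k l :: 'k and r :: 't
  show "sc (k + l) = sc k + sc l"
    by (simp add: sc_def smult_add_left cls_add)
  show "sc (k * l) = sc k * sc l"
    using cls_smult[of "l \<odot> \<one>" k] by (simp add: sc_def smult_mult)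
  show "sc 1 = 1"
    by (simp add: sc_def smult_one cls_one)
  obtain x where "x \<in> carrier A" "r = cls x"
    by (rule cls_surj)
  then show "r * sc k = sc k * r"
    by (simp add: sc_def smult_assoc_left smult_assoc_right flip: cls_mult)
qed

text \<open>First isomorphism theorem for \<open>Rep \<circ> F\<close>. The ring isomorphism comes
  from \<open>FactRing_iso_set\<close>; compatibility with scalars requires its value on each coset,
  where \<open>F\<close> is constant as it vanishes on \<open>J\<close>.\<close>

lemma algebra_isomorphic_quot:
  assumes "algebra_ideal B J" and hom: "ring_hom_ring B (type_algebra sc) F"
    and smult: "\<And>k x. x \<in> carrier B \<Longrightarrow> F (k \<odot>\<^bsub>B\<^esub> x) = sc k * F x"
    and surj: "F ` carrier B = UNIV"
    and kernel: "J = {x \<in> carrier B. F x = 0}"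
  shows "algebra_isomorphic (quot_algebra B J) (quot_algebra A I)"
proof -
  interpret B: algebra_ideal B J by fact
  interpret J: ideal J B by (rule B.ideal)
  interpret F: ring_hom_ring B "type_algebra sc" F by fact
  have Rep_hom: "ring_hom_ring B (quot_algebra A I) (Rep \<circ> F)"
    using F.hom_mult F.hom_add F.hom_one td.Rep
    by (intro ring_hom_ringI B.ring_axioms ring_quot) (simp_all add: Rep_mult Rep_add Rep_one)
  interpret \<Phi>: ring_hom_ring B "quot_algebra A I" "Rep \<circ> F"
    by (rule Rep_hom)
  have "a_kernel B (quot_algebra A I) (Rep \<circ> F) = J"
    unfolding a_kernel_def' kernel by (auto simp: td.Rep_inject simp flip: Rep_zero)
  moreover have "(Rep \<circ> F) ` carrier B = carrier (quot_algebra A I)"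
    using surj by (metis image_comp td.Rep_range)
  ultimately have iso: "(\<lambda>X. the_elem ((Rep \<circ> F) ` X)) \<in> ring_iso (B Quot J) (quot_algebra A I)"
    using \<Phi>.FactRing_iso_set by simp
  have the_elem: "the_elem ((Rep \<circ> F) ` (J +>\<^bsub>B\<^esub> x)) = Rep (F x)" if x: "x \<in> carrier B" for x
  proof -
    have "(Rep \<circ> F) y = Rep (F x)" if y: "y \<in> J +>\<^bsub>B\<^esub> x" for y
    proof -
      obtain j where j: "j \<in> J" "y = j \<oplus>\<^bsub>B\<^esub> x"
        using y by (auto simp: a_r_coset_def'[of B])
      have "j \<in> {x \<in> carrier B. F x = 0}"
        by (rule subst[OF kernel]) (rule j(1))
      then have "j \<in> carrier B" "F j = 0"
        by blast+
      then show ?thesis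
        using x F.hom_add[of j x] by (simp add: j(2))
    qed
    then have "(Rep \<circ> F) ` (J +>\<^bsub>B\<^esub> x) = (\<lambda>_. Rep (F x)) ` (J +>\<^bsub>B\<^esub> x)"
      by (rule image_cong[OF refl])
    also have "\<dots> = {Rep (F x)}"
      by (rule image_constant[OF J.a_rcos_self[OF x]])
    finally show ?thesis
      by (simp only: the_elem_eq)
  qed
  have "the_elem ((Rep \<circ> F) ` (k \<odot>\<^bsub>quot_algebra B J\<^esub> X)) =
      k \<odot>\<^bsub>quot_algebra A I\<^esub> the_elem ((Rep \<circ> F) ` X)"
    if X: "X \<in> carrier (quot_algebra B J)" for k X
  proof -
    obtain x where x: "x \<in> carrier B" "X = J +>\<^bsub>B\<^esub> x"
      using X by (auto simp: B.coset_surj)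
    obtain y where y: "y \<in> carrier A" "F x = cls y"
      by (rule cls_surj)
    have "the_elem ((Rep \<circ> F) ` (k \<odot>\<^bsub>quot_algebra B J\<^esub> X)) = Rep (sc k * F x)"
      using x by (simp only: B.coset_smult the_elem B.smult_closed smult)
    also have "\<dots> = k \<odot>\<^bsub>quot_algebra A I\<^esub> Rep (F x)"
      using y by (simp add: coset_smult flip: cls_smult)
    finally show ?thesis
      using x by (simp only: the_elem)
  qed
  moreover have "(\<lambda>X. the_elem ((Rep \<circ> F) ` X)) \<in> ring_iso (quot_algebra B J) (quot_algebra A I)"
    using iso unfolding ring_iso_def ring_hom_def by (simp add: quot_algebra_def)
  ultimately show ?thesis
    unfolding algebra_isomorphic_def algebra_iso_def by blast
qed

end

lemma central_scalars_id: "central_scalars (\<lambda>k. k :: 'k::field)"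
  by unfold_locales (simp_all add: mult.commute)

section \<open>The types of the two algebras\<close>

lemma algebra_ideal_D3: "algebra_ideal free_algebra (Idl\<^bsub>free_algebra\<^esub> D3_relations \<alpha> \<beta>)"
  by (rule unital_algebra.presented_algebra_ideal[OF unital_algebra_free_algebra]) simp

text \<open>The one-dimensional representation a = b = c = 1 satisfies all relations. Nontriviality
  of the quotient is what the axiom 0 \<noteq> 1 of \<open>ring_1\<close> demands of the type
  below.\<close>

lemma one_not_in_D3_ideal: "1 \<notin> Idl\<^bsub>free_algebra\<^esub> (D3_relations (1 :: 'k::field) 3)"
proof
  interpret central_scalars "\<lambda>k. k :: 'k"
    by (rule central_scalars_id)
  interpret h: ring_hom_ring free_algebra "type_algebra (\<lambda>k. k :: 'k)" "free_eval (\<lambda>_ :: D3_gen. 1)"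
    by (rule free_eval_hom)
  assume "1 \<in> Idl\<^bsub>free_algebra\<^esub> (D3_relations (1 :: 'k) 3)"
  then have "free_eval (\<lambda>_ :: D3_gen. 1) 1 = \<zero>\<^bsub>type_algebra (\<lambda>k. k :: 'k)\<^esub>"
    by (rule h.vanishes_on_genideal[rotated 2]) (auto simp: D3_relations_def Let_def simp del: single_numeral)
  then show False
    by simp
qed

interpretation D3: unital_algebra "D3 \<alpha> \<beta>"
  unfolding D3_def presented_algebra_def
  by (rule algebra_ideal.quotient_unital_algebra[OF algebra_ideal_D3])

lemma one_neq_zero_D3: "\<one>\<^bsub>D3 1 3\<^esub> \<noteq> \<zero>\<^bsub>D3 (1 :: 'k::field) 3\<^esub>"
proof
  let ?I = "Idl\<^bsub>free_algebra\<^esub> (D3_relations (1 :: 'k) 3)"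
  interpret algebra_ideal free_algebra ?I
    by (rule algebra_ideal_D3)
  assume "\<one>\<^bsub>D3 1 3\<^esub> = \<zero>\<^bsub>D3 (1 :: 'k) 3\<^esub>"
  then have "coset 1 = \<zero>\<^bsub>quot_algebra free_algebra ?I\<^esub>"
    using ring_hom_one[OF coset_hom] by (simp add: D3_def presented_algebra_def)
  then have "1 \<in> ?I"
    by (subst (asm) coset_eq_zero_iff) simp_all
  then show False
    using one_not_in_D3_ideal by blast
qed

typedef (overloaded) 'k d3 = "carrier (D3 (1 :: 'k::field) 3)"
  using D3.zero_closed by blast

setup_lifting type_definition_d3

instantiation d3 :: (field) ring_1
begin

lift_definition zero_d3 :: "'a d3" is "\<zero>\<^bsub>D3 1 3\<^esub>" by simp
lift_definition one_d3 :: "'a d3" is "\<one>\<^bsub>D3 1 3\<^esub>" by simp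
lift_definition plus_d3 :: "'a d3 \<Rightarrow> 'a d3 \<Rightarrow> 'a d3" is "add (D3 1 3)" by simp
lift_definition times_d3 :: "'a d3 \<Rightarrow> 'a d3 \<Rightarrow> 'a d3" is "monoid.mult (D3 1 3)" by simp
lift_definition uminus_d3 :: "'a d3 \<Rightarrow> 'a d3" is "a_inv (D3 1 3)" by simp
lift_definition minus_d3 :: "'a d3 \<Rightarrow> 'a d3 \<Rightarrow> 'a d3" is "a_minus (D3 1 3)" by simp

instance
proof
  fix a b c :: "'a d3"
  show "a + b + c = a + (b + c)" by transfer (rule D3.a_assoc)
  show "a + b = b + a" by transfer (rule D3.a_comm)
  show "0 + a = a" by transfer (rule D3.l_zero)
  show "- a + a = 0" by transfer (rule D3.l_neg)
  show "a - b = a + - b" by transfer (rule D3.minus_eq)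
  show "a * b * c = a * (b * c)" by transfer (rule D3.m_assoc)
  show "1 * a = a" by transfer (rule D3.l_one)
  show "a * 1 = a" by transfer (rule D3.r_one)
  show "(a + b) * c = a * c + b * c" by transfer (rule D3.l_distr)
  show "a * (b + c) = a * b + a * c" by transfer (rule D3.r_distr)
  show "(0 :: 'a d3) \<noteq> 1" by transfer (metis one_neq_zero_D3)
qed

end

interpretation d3: typed_quotient free_algebra "Idl\<^bsub>free_algebra\<^esub> (D3_relations (1 :: 'k::field) 3)"
  "Rep_d3 :: 'k d3 \<Rightarrow> _" Abs_d3
proof (intro typed_quotient.intro typed_quotient_axioms.intro algebra_ideal_D3)
  have D3: "quot_algebra free_algebra (Idl\<^bsub>free_algebra\<^esub> D3_relations (1 :: 'k) 3) = D3 1 3"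
    by (simp add: D3_def presented_algebra_def)
  show "type_definition (Rep_d3 :: 'k d3 \<Rightarrow> _) Abs_d3
      (carrier (quot_algebra free_algebra (Idl\<^bsub>free_algebra\<^esub> D3_relations (1 :: 'k) 3)))"
    unfolding D3 by (rule type_definition_d3)
qed (simp_all add: D3_def presented_algebra_def plus_d3.rep_eq times_d3.rep_eq one_d3.rep_eq zero_d3.rep_eq)


section \<open>The quotient of the path algebra of the two-vertex quiver\<close>

interpretation Q2: vertex_finite_digraph Q2
  by unfold_locales (auto simp: Q2_def)

lemma keys_diff_closed:
  "Poly_Mapping.keys f \<subseteq> S \<Longrightarrow> Poly_Mapping.keys g \<subseteq> S \<Longrightarrow> Poly_Mapping.keys (f - g) \<subseteq> S"
  using Poly_Mapping.keys_diff[of f g] by blast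

lemma keys_add_closed:
  "Poly_Mapping.keys f \<subseteq> S \<Longrightarrow> Poly_Mapping.keys g \<subseteq> S \<Longrightarrow> Poly_Mapping.keys (f + g) \<subseteq> S"
  using Poly_Mapping.keys_add[of f g] by blast

lemma index_pairs: "{(i :: nat, j :: nat). i \<in> {1, 2} \<and> j \<in> {1, 2} \<and> i + j = 3} = {(1, 2), (2, 1)}"
  by auto

lemma arcs_Q2_iff: "(l, i, j) \<in> arcs Q2 \<longleftrightarrow> (i, j) \<in> {(1, 2), (2, 1)}"
  by (cases l) (auto simp: Q2_def)

lemma Q2_relationsE:
  assumes "r \<in> Q2_relations"
  obtains i j where "(i, j) \<in> {(1, 2), (2, 1)}"
    and "r \<in> {arr_u i j \<star> arr_v j i - arr_v i j \<star> arr_u j i,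
       arr_u i j \<star> arr_v j i + arr_v i j \<star> arr_w j i + arr_u i j \<star> arr_w j i,
       arr_u i j \<star> arr_v j i \<star> arr_w i j}"
  using assms unfolding Q2_relations_def index_pairs by blast

lemma arr_closed:
  assumes "(i, j) \<in> {(1, 2), (2, 1)}"
  shows "Poly_Mapping.keys (arr_u i j) \<subseteq> paths Q2" and "Poly_Mapping.keys (arr_v i j) \<subseteq> paths Q2"
    and "Poly_Mapping.keys (arr_w i j) \<subseteq> paths Q2"
proof -
  have "(tail Q2 (l, i, j), [(l, i, j)], head Q2 (l, i, j)) \<in> paths Q2" for l
    using assms by (intro Q2.arrow_path) (simp only: arcs_Q2_iff)
  then show u: "Poly_Mapping.keys (arr_u i j) \<subseteq> paths Q2" and v: "Poly_Mapping.keys (arr_v i j) \<subseteq> paths Q2"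
    by (simp_all add: arr_u_def arr_v_def path_arrow_def)
  show "Poly_Mapping.keys (arr_w i j) \<subseteq> paths Q2"
    unfolding arr_w_def using u v by (intro keys_diff_closed) simp_all
qed

lemma swap_index_pair: "(i, j) \<in> {(1, 2), (2, 1)} \<Longrightarrow> (j, i) \<in> {(1 :: nat, 2 :: nat), (2, 1)}"
  by auto

lemma Q2_relations_closed: "Q2_relations \<subseteq> carrier (path_algebra Q2)"
proof
  fix r :: "(nat, arrow) path \<Rightarrow>\<^sub>0 'k::field"
  assume "r \<in> Q2_relations"
  then show "r \<in> carrier (path_algebra Q2)"
  proof (rule Q2_relationsE)
    fix i j :: nat
    assume ij: "(i, j) \<in> {(1, 2), (2, 1)}"
      and r: "r \<in> {arr_u i j \<star> arr_v j i - arr_v i j \<star> arr_u j i,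
       arr_u i j \<star> arr_v j i + arr_v i j \<star> arr_w j i + arr_u i j \<star> arr_w j i,
       arr_u i j \<star> arr_v j i \<star> arr_w i j}"
    note closed = arr_closed[OF ij] arr_closed[OF swap_index_pair[OF ij]]
    from r show "r \<in> carrier (path_algebra Q2)"
      unfolding path_algebra_simps insert_iff empty_iff
      by (elim disjE FalseE; hypsubst) (intro keys_diff_closed keys_add_closed Q2.path_mult_closed closed)+
  qed
qed

text \<open>Evaluation is multiplicative on combinations of genuine paths, and every factor of a
  relation is one; so only the values of the arrows have to be checked.\<close>

lemma (in central_scalars) Q2_relations_vanish:
  assumes "path_rep sc Q2 e g"
    and comm: "\<And>i j. (i, j) \<in> {(1, 2), (2, 1)} \<Longrightarrow> g (U, i, j) * g (V, j, i) = g (V, i, j) * g (U, j, i)"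
    and quadratic: "\<And>i j. (i, j) \<in> {(1, 2), (2, 1)} \<Longrightarrow>
      g (U, i, j) * g (V, j, i) + g (V, i, j) * (- g (U, j, i) - g (V, j, i))
        + g (U, i, j) * (- g (U, j, i) - g (V, j, i)) = 0"
    and cubic: "\<And>i j. (i, j) \<in> {(1, 2), (2, 1)} \<Longrightarrow>
      g (U, i, j) * g (V, j, i) * (- g (U, i, j) - g (V, i, j)) = 0"
    and "r \<in> Q2_relations"
  shows "path_rep.path_eval sc e g r = 0"
proof -
  interpret path_rep sc Q2 e g by fact
  obtain i j where ij: "(i, j) \<in> {(1 :: nat, 2 :: nat), (2, 1)}" and
    r: "r \<in> {arr_u i j \<star> arr_v j i - arr_v i j \<star> arr_u j i,
       arr_u i j \<star> arr_v j i + arr_v i j \<star> arr_w j i + arr_u i j \<star> arr_w j i,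
       arr_u i j \<star> arr_v j i \<star> arr_w i j}"
    using \<open>r \<in> Q2_relations\<close> by (rule Q2_relationsE)
  have arcs: "(l, i, j) \<in> arcs Q2" "(l, j, i) \<in> arcs Q2" for l
    using ij swap_index_pair[OF ij] by (simp_all only: arcs_Q2_iff)
  note closed = arr_closed[OF ij] arr_closed[OF swap_index_pair[OF ij]]
  have vals: "path_eval (arr_u i j) = g (U, i, j)" "path_eval (arr_v i j) = g (V, i, j)"
    "path_eval (arr_u j i) = g (U, j, i)" "path_eval (arr_v j i) = g (V, j, i)"
    "path_eval (arr_w i j) = - g (U, i, j) - g (V, i, j)"
    "path_eval (arr_w j i) = - g (U, j, i) - g (V, j, i)"
    using arcs by (simp_all add: arr_u_def arr_v_def arr_w_def)
  show ?thesis
    using r comm[OF ij] quadratic[OF ij] cubic[OF ij]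
    by (auto simp only: insert_iff empty_iff path_eval_simps path_eval_mult closed Q2.path_mult_closed vals
        diff_self)
qed

lemma algebra_ideal_Q2: "algebra_ideal (path_algebra Q2) (Idl\<^bsub>path_algebra Q2\<^esub> Q2_relations)"
  by (rule unital_algebra.presented_algebra_ideal[OF Q2.unital_algebra_path_algebra Q2_relations_closed])

abbreviation Q2_algebra :: "('k::field, _) module" where
  "Q2_algebra \<equiv> presented_algebra (path_algebra Q2) Q2_relations"

interpretation Q2_algebra: unital_algebra "Q2_algebra :: ('k::field, _) module"
  unfolding presented_algebra_def
  by (rule algebra_ideal.quotient_unital_algebra[OF algebra_ideal_Q2])

lemma one_neq_zero_Q2_algebra: "\<one>\<^bsub>Q2_algebra\<^esub> \<noteq> \<zero>\<^bsub>Q2_algebra :: ('k::field, _) module\<^esub>"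
proof
  let ?I = "Idl\<^bsub>path_algebra Q2\<^esub> (Q2_relations :: ((nat, arrow) path \<Rightarrow>\<^sub>0 'k) set)"
  interpret algebra_ideal "path_algebra Q2" ?I
    by (rule algebra_ideal_Q2)
  interpret central_scalars "\<lambda>k. k :: 'k"
    by (rule central_scalars_id)
  \<comment> \<open>The simple representation at vertex 1: all arrows act as zero, which kills the
    relations but not the unit.\<close>
  let ?e = "\<lambda>v :: nat. if v = 1 then 1 else 0 :: 'k" and ?g = "\<lambda>_ :: arrow. 0 :: 'k"
  interpret path_rep "\<lambda>k. k :: 'k" Q2 ?e ?g
    by unfold_locales (auto simp: Q2_def)
  interpret h: ring_hom_ring "path_algebra Q2" "type_algebra (\<lambda>k. k :: 'k)" path_eval
    by (rule path_eval_hom)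
  assume "\<one>\<^bsub>Q2_algebra\<^esub> = \<zero>\<^bsub>Q2_algebra :: ('k, _) module\<^esub>"
  then have "coset \<one>\<^bsub>path_algebra Q2\<^esub> = \<zero>\<^bsub>quot_algebra (path_algebra Q2) ?I\<^esub>"
    using ring_hom_one[OF coset_hom] by (simp only: presented_algebra_def)
  then have "\<one>\<^bsub>path_algebra Q2\<^esub> \<in> ?I"
    by (subst (asm) coset_eq_zero_iff) (rule one_closed)
  then have "path_eval \<one>\<^bsub>path_algebra Q2\<^esub> = \<zero>\<^bsub>type_algebra (\<lambda>k. k :: 'k)\<^esub>"
    by (rule h.vanishes_on_genideal[OF Q2_relations_closed, rotated])
      (use Q2_relations_vanish[OF path_rep_axioms] in simp)
  then show False
    by (simp only: h.hom_one type_algebra_simps one_neq_zero)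
qed

typedef (overloaded) 'k q2 = "carrier (Q2_algebra :: ('k::field, _) module)"
  using Q2_algebra.zero_closed by blast

setup_lifting type_definition_q2

instantiation q2 :: (field) ring_1
begin

lift_definition zero_q2 :: "'a q2" is "\<zero>\<^bsub>Q2_algebra\<^esub>" by simp
lift_definition one_q2 :: "'a q2" is "\<one>\<^bsub>Q2_algebra\<^esub>" by simp
lift_definition plus_q2 :: "'a q2 \<Rightarrow> 'a q2 \<Rightarrow> 'a q2" is "add Q2_algebra" by simp
lift_definition times_q2 :: "'a q2 \<Rightarrow> 'a q2 \<Rightarrow> 'a q2" is "monoid.mult Q2_algebra" by simp
lift_definition uminus_q2 :: "'a q2 \<Rightarrow> 'a q2" is "a_inv Q2_algebra" by simp
lift_definition minus_q2 :: "'a q2 \<Rightarrow> 'a q2 \<Rightarrow> 'a q2" is "a_minus Q2_algebra" by simp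

instance
proof
  fix a b c :: "'a q2"
  show "a + b + c = a + (b + c)" by transfer (rule Q2_algebra.a_assoc)
  show "a + b = b + a" by transfer (rule Q2_algebra.a_comm)
  show "0 + a = a" by transfer (rule Q2_algebra.l_zero)
  show "- a + a = 0" by transfer (rule Q2_algebra.l_neg)
  show "a - b = a + - b" by transfer (rule Q2_algebra.minus_eq)
  show "a * b * c = a * (b * c)" by transfer (rule Q2_algebra.m_assoc)
  show "1 * a = a" by transfer (rule Q2_algebra.l_one)
  show "a * 1 = a" by transfer (rule Q2_algebra.r_one)
  show "(a + b) * c = a * c + b * c" by transfer (rule Q2_algebra.l_distr)
  show "a * (b + c) = a * b + a * c" by transfer (rule Q2_algebra.r_distr)
  show "(0 :: 'a q2) \<noteq> 1" by transfer (metis one_neq_zero_Q2_algebra)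
qed

end

interpretation q2: typed_quotient "path_algebra Q2" "Idl\<^bsub>path_algebra Q2\<^esub> (Q2_relations :: (_ \<Rightarrow>\<^sub>0 'k::field) set)"
  "Rep_q2 :: 'k q2 \<Rightarrow> _" Abs_q2
proof (intro typed_quotient.intro typed_quotient_axioms.intro algebra_ideal_Q2)
  have Q2_algebra: "quot_algebra (path_algebra Q2) (Idl\<^bsub>path_algebra Q2\<^esub> Q2_relations) =
      (Q2_algebra :: ('k, _) module)"
    by (simp add: presented_algebra_def)
  show "type_definition (Rep_q2 :: 'k q2 \<Rightarrow> _) Abs_q2
      (carrier (quot_algebra (path_algebra Q2) (Idl\<^bsub>path_algebra Q2\<^esub> Q2_relations)))"
    unfolding Q2_algebra by (rule type_definition_q2)
qed (simp_all only: presented_algebra_def plus_q2.rep_eq times_q2.rep_eq one_q2.rep_eq zero_q2.rep_eq)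

text \<open>The substitutions g -> s g and g -> g / s are mutually inverse. The second sends each
  relation of D_3(1, 3) to s^(-2) times one of D_3(s^2, 3 s^2), hence the one ideal into the
  other.\<close>

lemma D3_ideal_rescale:
  fixes s :: "'k::field"
  assumes s: "s \<noteq> 0"
    and x: "central_scalars.free_eval free_const (\<lambda>g. free_const s * free_gen g) x \<in> Idl\<^bsub>free_algebra\<^esub> (D3_relations 1 3)"
  shows "x \<in> Idl\<^bsub>free_algebra\<^esub> (D3_relations (s * s) (3 * (s * s)))"
proof -
  let ?J = "Idl\<^bsub>free_algebra\<^esub> (D3_relations (s * s) (3 * (s * s)))"
  let ?t = "free_const (1 / s) :: D3_gen free_monoid \<Rightarrow>\<^sub>0 'k"
  interpret central_scalars "free_const :: 'k \<Rightarrow> (D3_gen free_monoid \<Rightarrow>\<^sub>0 'k)"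
    by (rule central_scalars_free_const)
  interpret J: algebra_ideal free_algebra ?J
    by (rule algebra_ideal_D3)
  interpret JI: ideal ?J free_algebra
    by (rule J.ideal)
  let ?\<rho> = "free_eval (\<lambda>g. free_const s * free_gen g)" and ?\<tau> = "free_eval (\<lambda>g. ?t * free_gen g)"
  interpret h: ring_hom_ring free_algebra "quot_algebra free_algebra ?J" "\<lambda>p. J.coset (?\<tau> p)"
    using ring_hom_mult[OF J.coset_hom] ring_hom_add[OF J.coset_hom] ring_hom_one[OF J.coset_hom]
    by (intro ring_hom_ringI d3.ring_axioms J.ring_quot) simp_all
  have inverse: "?\<tau> (?\<rho> p) = p" for p
  proof (induction p rule: free_algebra_induct)
    case (gen g)
    have "?\<tau> (?\<rho> (free_gen g)) = free_const (s * (1 / s)) * free_gen g"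
      by (simp only: free_eval_simps free_eval_mult sc_mult mult.assoc)
    then show ?case
      using s by (simp add: mult.assoc)
  qed simp_all
  have J_mult: "free_const c * p \<in> ?J" if "p \<in> D3_relations (s * s) (3 * (s * s))" for c p
    using JI.I_l_closed[of p "free_const c"] d3.genideal_self[of "D3_relations (s * s) (3 * (s * s))"] that
    by auto
  have swap: "?t * p * (?t * q) = free_const (1 / (s * s)) * (p * q)" for p q
  proof -
    have "?t * p * (?t * q) = ?t * ?t * (p * q)"
      by (metis mult.assoc sc_central)
    then show ?thesis
      by (simp add: mult_single)
  qed
  \<comment> \<open>The constants 1 and 3 must show the same factor s^(-2) as the rescaled words of
    length two.\<close>
  have const: "free_const c = free_const (1 / (s * s)) * free_const (c * (s * s))" for c
    using s by (simp add: mult_single)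
  have "?\<tau> r \<in> ?J" if r: "r \<in> D3_relations 1 3" for r
  proof -
    have "\<exists>p \<in> D3_relations (s * s) (3 * (s * s)). ?\<tau> r = free_const (1 / (s * s)) * p"
      using r const[of 1] const[of 3] unfolding D3_relations_def Let_def
      by (auto simp: swap right_diff_distrib distrib_left simp del: single_numeral single_one)
    then show ?thesis
      using J_mult by auto
  qed
  then have "J.coset (?\<tau> (?\<rho> x)) = \<zero>\<^bsub>quot_algebra free_algebra ?J\<^esub>"
    by (intro h.vanishes_on_genideal[OF _ _ x]) (auto simp: J.coset_eq_zero_iff)
  then show ?thesis
    by (simp add: inverse J.coset_eq_zero_iff)
qed

section \<open>The ring relations inside the two quotient types\<close>

lemma cls_d3_simps:
  fixes p q :: "D3_gen free_monoid \<Rightarrow>\<^sub>0 'k::field"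
  shows "d3.cls (p + q) = d3.cls p + d3.cls q"
    and "d3.cls (p - q) = d3.cls p - d3.cls q"
    and "d3.cls (p * q) = d3.cls p * d3.cls q"
    and "d3.cls 1 = 1"
    and "d3.cls (free_const c) = d3.sc c"
proof -
  show add: "d3.cls (p + q) = d3.cls p + d3.cls q" for p q :: "D3_gen free_monoid \<Rightarrow>\<^sub>0 'k"
    using d3.cls_add[of p q] by simp
  show "d3.cls (p - q) = d3.cls p - d3.cls q"
    using add[of "p - q" q] by simp
  show "d3.cls (p * q) = d3.cls p * d3.cls q"
    using d3.cls_mult[of p q] by simp
  show "d3.cls 1 = 1"
    using d3.cls_one by simp
  show "d3.cls (free_const c) = d3.sc c"
    by (simp add: d3.sc_def mult_map_scale_conv_mult)
qed

lemma (in central_scalars) sc_three: "sc 3 = 1 + 1 + 1"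
proof -
  have "(3 :: 'k) = 1 + 1 + 1" by simp
  then show ?thesis by (simp only: sc_add sc_one)
qed

lemma D3_triple_cls_d3:
  "D3_triple (d3.cls (free_gen GenA) :: 'k::field d3) (d3.cls (free_gen GenB)) (d3.cls (free_gen GenC))"
proof -
  have zero: "d3.cls r = (0 :: 'k d3)" if "r \<in> D3_relations 1 3" for r
    using d3.genideal_self[of "D3_relations (1 :: 'k) 3"] that by (subst d3.cls_eq_zero_iff) auto
  have eqs: "d3.cls (free_gen GenA) * d3.cls (free_gen GenA) - (d3.sc 1 :: 'k d3) = 0"
    "d3.cls (free_gen GenB) * d3.cls (free_gen GenB) - (d3.sc 1 :: 'k d3) = 0"
    "d3.cls (free_gen GenC) * d3.cls (free_gen GenC) - (d3.sc 1 :: 'k d3) = 0"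
    "d3.cls (free_gen GenC) * d3.cls (free_gen GenA) + d3.cls (free_gen GenB) * d3.cls (free_gen GenC)
      + d3.cls (free_gen GenA) * d3.cls (free_gen GenB) - (d3.sc 3 :: 'k d3) = 0"
    "d3.cls (free_gen GenC) * d3.cls (free_gen GenB) + d3.cls (free_gen GenB) * d3.cls (free_gen GenA)
      + d3.cls (free_gen GenA) * d3.cls (free_gen GenC) - (d3.sc 3 :: 'k d3) = 0"
    unfolding cls_d3_simps[symmetric] by (rule zero; simp only: D3_relations_def Let_def insert_iff refl simp_thms)+
  show ?thesis
    by unfold_locales (use eqs in \<open>simp_all only: d3.sc_one d3.sc_three right_minus_eq\<close>)
qed

lemma cls_q2_simps:
  fixes f g :: "(nat, arrow) path \<Rightarrow>\<^sub>0 'k::field"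
  assumes f: "Poly_Mapping.keys f \<subseteq> paths Q2" and g: "Poly_Mapping.keys g \<subseteq> paths Q2"
  shows "q2.cls (f + g) = q2.cls f + q2.cls g"
    and "q2.cls (f - g) = q2.cls f - q2.cls g"
    and "q2.cls (f \<star> g) = q2.cls f * q2.cls g"
proof -
  show "q2.cls (f + g) = q2.cls f + q2.cls g"
    using q2.cls_add[of f g] f g by simp
  show "q2.cls (f - g) = q2.cls f - q2.cls g"
    using q2.cls_add[of "f - g" g] f g by (simp add: keys_diff_closed)
  show "q2.cls (f \<star> g) = q2.cls f * q2.cls g"
    using q2.cls_mult[of f g] f g by simp
qed

lemma cls_q2_zero: "q2.cls 0 = 0"
  using q2.cls_add[of 0 0] by simp

definition q2_vertex :: "nat \<Rightarrow> 'k::field q2" where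
  "q2_vertex v = q2.cls (Poly_Mapping.single (v, [], v) 1)"

lemma q2_vertex_mult:
  assumes "v \<in> {1, 2}" "w \<in> {1, 2}"
  shows "q2_vertex v * q2_vertex w = (if v = w then q2_vertex v else 0 :: 'k::field q2)"
proof -
  have keys: "Poly_Mapping.keys (Poly_Mapping.single (v, [], v) (1 :: 'k)) \<subseteq> paths Q2"
    if "v \<in> {1, 2}" for v
    using that Q2.vertex_path[of v] by (simp add: Q2_def)
  show ?thesis
    unfolding q2_vertex_def cls_q2_simps(3)[OF keys keys, OF assms, symmetric] by (simp add: cls_q2_zero)
qed

lemma q2_vertex_sum: "q2_vertex 1 + q2_vertex 2 = (1 :: 'k::field q2)"
proof -
  have keys: "Poly_Mapping.keys (Poly_Mapping.single (v, [], v) (1 :: 'k)) \<subseteq> paths Q2"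
    if "v \<in> {1, 2}" for v
    using that Q2.vertex_path[of v] by (simp add: Q2_def)
  have "\<one>\<^bsub>path_algebra Q2\<^esub> = Poly_Mapping.single (1, [], 1) (1 :: 'k) + Poly_Mapping.single (2, [], 2) 1"
    by (simp add: Q2_def)
  then show ?thesis
    unfolding q2_vertex_def using q2.cls_one cls_q2_simps(1)[OF keys keys, of 1 2]
    by (metis insertCI)
qed

lemma q2_vertex_arrow:
  assumes ij: "(i, j) \<in> {(1, 2), (2, 1)}"
  shows "q2_vertex i * q2.cls (arr_u i j) = (q2.cls (arr_u i j) :: 'k::field q2)"
    and "q2_vertex i * q2.cls (arr_v i j) = (q2.cls (arr_v i j) :: 'k::field q2)"
    and "q2.cls (arr_u i j) * q2_vertex j = (q2.cls (arr_u i j) :: 'k::field q2)"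
    and "q2.cls (arr_v i j) * q2_vertex j = (q2.cls (arr_v i j) :: 'k::field q2)"
proof -
  have keys: "Poly_Mapping.keys (Poly_Mapping.single (v, [], v) (1 :: 'k)) \<subseteq> paths Q2"
    if "v \<in> {i, j}" for v
    using that ij Q2.vertex_path[of v] by (auto simp: Q2_def)
  have ends: "tail Q2 (l, i, j) = i" "head Q2 (l, i, j) = j" for l
    by (simp_all add: Q2_def)
  have eqs: "Poly_Mapping.single (i, [], i) 1 \<star> arr_u i j = (arr_u i j :: _ \<Rightarrow>\<^sub>0 'k)"
    "Poly_Mapping.single (i, [], i) 1 \<star> arr_v i j = (arr_v i j :: _ \<Rightarrow>\<^sub>0 'k)"
    "arr_u i j \<star> Poly_Mapping.single (j, [], j) 1 = (arr_u i j :: _ \<Rightarrow>\<^sub>0 'k)"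
    "arr_v i j \<star> Poly_Mapping.single (j, [], j) 1 = (arr_v i j :: _ \<Rightarrow>\<^sub>0 'k)"
    by (simp_all add: arr_u_def arr_v_def path_arrow_def ends)
  show "q2_vertex i * q2.cls (arr_u i j) = (q2.cls (arr_u i j) :: 'k q2)"
    "q2_vertex i * q2.cls (arr_v i j) = (q2.cls (arr_v i j) :: 'k q2)"
    "q2.cls (arr_u i j) * q2_vertex j = (q2.cls (arr_u i j) :: 'k q2)"
    "q2.cls (arr_v i j) * q2_vertex j = (q2.cls (arr_v i j) :: 'k q2)"
    unfolding q2_vertex_def
    by (subst cls_q2_simps(3)[symmetric]; (rule keys arr_closed[OF ij])?; simp add: eqs)+
qed

interpretation q2: two_cycle_rep "q2_vertex 1 :: 'k::field q2" "q2_vertex 2"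
  "q2.cls (arr_u 1 2)" "q2.cls (arr_v 1 2)" "q2.cls (arr_u 2 1)" "q2.cls (arr_v 2 1)"
  by unfold_locales (simp_all add: q2_vertex_mult q2_vertex_arrow q2_vertex_sum del: One_nat_def)

lemma coinvariant_pair_q2:
  "coinvariant_pair (q2_vertex 1 - q2_vertex 2 :: 'k::field q2)
    (q2.cls (arr_u 1 2) + q2.cls (arr_u 2 1)) (q2.cls (arr_v 1 2) + q2.cls (arr_v 2 1))"
proof -
  have zero: "q2.cls r = (0 :: 'k q2)" if "r \<in> Q2_relations" for r
    by (rule iffD2[OF q2.cls_eq_zero_iff[OF subsetD[OF Q2_relations_closed that]]
          subsetD[OF ring.genideal_self[OF Q2.ring_path_algebra Q2_relations_closed] that]])
  have rels: "q2.cls (arr_u i j) * q2.cls (arr_v j i) = (q2.cls (arr_v i j) * q2.cls (arr_u j i) :: 'k q2)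
    \<and> q2.cls (arr_u i j) * q2.cls (arr_v j i)
      + q2.cls (arr_v i j) * (- q2.cls (arr_u j i) - q2.cls (arr_v j i))
      + q2.cls (arr_u i j) * (- q2.cls (arr_u j i) - q2.cls (arr_v j i)) = (0 :: 'k q2)
    \<and> q2.cls (arr_u i j) * q2.cls (arr_v j i) * (- q2.cls (arr_u i j) - q2.cls (arr_v i j)) = (0 :: 'k q2)"
    if ij: "(i, j) \<in> {(1, 2), (2, 1)}" for i j
  proof -
    note closed = arr_closed[OF ij] arr_closed[OF swap_index_pair[OF ij]]
    have w: "q2.cls (arr_w i j) = (- q2.cls (arr_u i j) - q2.cls (arr_v i j) :: 'k q2)"
      if "(i, j) \<in> {(1, 2), (2, 1)}" for i j
    proof -
      note closed = arr_closed[OF that]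
      \<comment> \<open>The leading minus sign becomes a difference from 0, to which the
        compatibility of \<open>cls\<close> with differences applies.\<close>
      have "arr_w i j = 0 - arr_u i j - (arr_v i j :: _ \<Rightarrow>\<^sub>0 'k)"
        by (simp add: arr_w_def)
      then show ?thesis
        by (simp only: cls_q2_simps closed keys_diff_closed cls_q2_zero keys_zero empty_subsetI)
          (simp only: diff_0)
    qed
    have rel: "r \<in> Q2_relations" if "r \<in> {arr_u i j \<star> arr_v j i - arr_v i j \<star> arr_u j i,
       arr_u i j \<star> arr_v j i + arr_v i j \<star> arr_w j i + arr_u i j \<star> arr_w j i,
       arr_u i j \<star> arr_v j i \<star> arr_w i j}" for r :: "_ \<Rightarrow>\<^sub>0 'k"
      using that ij unfolding Q2_relations_def index_pairs by blast
    have "q2.cls (arr_u i j \<star> arr_v j i - arr_v i j \<star> arr_u j i) = (0 :: 'k q2)"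
      "q2.cls (arr_u i j \<star> arr_v j i + arr_v i j \<star> arr_w j i + arr_u i j \<star> arr_w j i) = (0 :: 'k q2)"
      "q2.cls (arr_u i j \<star> arr_v j i \<star> arr_w i j) = (0 :: 'k q2)"
      by (rule zero, rule rel, simp)+
    then show ?thesis
      by (simp only: cls_q2_simps closed keys_add_closed Q2.path_mult_closed w[OF ij] w[OF swap_index_pair[OF ij]]
          right_minus_eq)
  qed
  show ?thesis
    by (rule q2.coinvariant_pair) (use rels in blast)+
qed

section \<open>The isomorphism\<close>

context
  fixes s :: "'k::field"
  assumes two: "(2 :: 'k) \<noteq> 0" and s: "s \<noteq> 0"
begin

abbreviation "x\<^sub>D \<equiv> d3.cls (free_gen GenA) :: 'k d3"
abbreviation "y\<^sub>D \<equiv> d3.cls (free_gen GenB) :: 'k d3"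
abbreviation "z\<^sub>D \<equiv> d3.cls (free_gen GenC) :: 'k d3"

lemma d3_quarter: "D3_triple_quarter x\<^sub>D y\<^sub>D z\<^sub>D (d3.sc (1 / 4))"
proof (intro D3_triple_quarter.intro D3_triple_cls_d3 D3_triple_quarter_axioms.intro)
  have "(4 :: 'k) = 2 * 2" by simp
  then have "(4 :: 'k) \<noteq> 0" using two by (metis mult_eq_0_iff)
  then have "1 / 4 + 1 / 4 + 1 / 4 + 1 / 4 = (1 :: 'k)"
    by (simp add: field_simps)
  then show "d3.sc (1 / 4) + d3.sc (1 / 4) + d3.sc (1 / 4) + d3.sc (1 / 4) = (1 :: 'k d3)"
    by (metis d3.sc_add d3.sc_one)
qed (rule d3.sc_central)

interpretation D: D3_triple_quarter x\<^sub>D y\<^sub>D z\<^sub>D "d3.sc (1 / 4)"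
  by (rule d3_quarter)

interpretation D: coinvariant_pair_half x\<^sub>D D.u D.v "d3.sc (1 / 2)"
proof (intro coinvariant_pair_half.intro coinvariant_pair_half_axioms.intro)
  show "coinvariant_pair x\<^sub>D D.u D.v" ..
  have "1 / 2 + 1 / 2 = (1 :: 'k)"
    using two by (simp add: field_simps)
  then show "d3.sc (1 / 2) + d3.sc (1 / 2) = (1 :: 'k d3)"
    by (metis d3.sc_add d3.sc_one)
qed (rule d3.sc_central)

interpretation C: two_cycle_rep D.e\<^sub>1 D.e\<^sub>2 "D.e\<^sub>1 * D.u" "D.e\<^sub>1 * D.v" "D.e\<^sub>2 * D.u" "D.e\<^sub>2 * D.v"
  by (rule D.two_cycle_rep)

definition d3_vertex :: "nat \<Rightarrow> 'k d3" where
  "d3_vertex v = (if v = 1 then D.e\<^sub>1 else D.e\<^sub>2)"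

text \<open>The idempotent at the source fixes the target too, since \<open>u\<close> and
  \<open>v\<close> exchange the two idempotents.\<close>

definition d3_arrow :: "arrow \<Rightarrow> 'k d3" where
  "d3_arrow a = (case a of (l, i, j) \<Rightarrow> d3_vertex i * (case l of U \<Rightarrow> D.u | V \<Rightarrow> D.v))"

interpretation G: path_rep d3.sc Q2 d3_vertex d3_arrow
proof unfold_locales
  show "d3_vertex v * d3_vertex w = (if v = w then d3_vertex v else 0)"
    if "v \<in> verts Q2" "w \<in> verts Q2" for v w
    using that by (auto simp: Q2_def d3_vertex_def D.idem D.orth)
  show "(\<Sum>v\<in>verts Q2. d3_vertex v) = 1"
    by (simp add: Q2_def d3_vertex_def D.unit)
  fix a assume "a \<in> arcs Q2"
  then consider "a = (U, 1, 2)" | "a = (V, 1, 2)" | "a = (U, 2, 1)" | "a = (V, 2, 1)"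
    by (auto simp: Q2_def)
  note cases = this
  show "d3_vertex (tail Q2 a) * d3_arrow a = d3_arrow a"
    by (rule cases) (simp_all add: Q2_def d3_vertex_def d3_arrow_def C.sources)
  show "d3_arrow a * d3_vertex (head Q2 a) = d3_arrow a"
    by (rule cases) (simp_all add: Q2_def d3_vertex_def d3_arrow_def C.targets)
qed

lemma path_eval_Q2_relations:
  assumes "r \<in> Q2_relations"
  shows "G.path_eval r = 0"
proof (rule d3.Q2_relations_vanish[OF G.path_rep_axioms _ _ _ assms])
  fix i j :: nat
  assume "(i, j) \<in> {(1, 2), (2, 1)}"
  then have "(d3_vertex i, d3_vertex j) \<in> {(D.e\<^sub>1, D.e\<^sub>2), (D.e\<^sub>2, D.e\<^sub>1)}"
    by (auto simp: d3_vertex_def)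
  note rels = D.quiver_relations[OF this]
  show "d3_arrow (U, i, j) * d3_arrow (V, j, i) = d3_arrow (V, i, j) * d3_arrow (U, j, i)"
    using rels(1) by (simp add: d3_arrow_def)
  show "d3_arrow (U, i, j) * d3_arrow (V, j, i)
      + d3_arrow (V, i, j) * (- d3_arrow (U, j, i) - d3_arrow (V, j, i))
      + d3_arrow (U, i, j) * (- d3_arrow (U, j, i) - d3_arrow (V, j, i)) = 0"
    using rels(2) by (simp only: d3_arrow_def prod.case arrow_label.case)
  show "d3_arrow (U, i, j) * d3_arrow (V, j, i) * (- d3_arrow (U, i, j) - d3_arrow (V, i, j)) = 0"
    using rels(3) by (simp only: d3_arrow_def prod.case arrow_label.case)
qed

abbreviation "\<sigma>\<^sub>Q \<equiv> q2_vertex 1 - q2_vertex 2 :: 'k q2"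
abbreviation "u\<^sub>Q \<equiv> q2.cls (arr_u 1 2) + q2.cls (arr_u 2 1) :: 'k q2"
abbreviation "v\<^sub>Q \<equiv> q2.cls (arr_v 1 2) + q2.cls (arr_v 2 1) :: 'k q2"

interpretation Q: coinvariant_pair \<sigma>\<^sub>Q u\<^sub>Q v\<^sub>Q
  by (rule coinvariant_pair_q2)

definition q2_gen :: "D3_gen \<Rightarrow> 'k q2" where
  "q2_gen g = q2.sc s * (case g of GenA \<Rightarrow> \<sigma>\<^sub>Q | GenB \<Rightarrow> \<sigma>\<^sub>Q * exp2 u\<^sub>Q | GenC \<Rightarrow> \<sigma>\<^sub>Q * exp2 (u\<^sub>Q + v\<^sub>Q))"

abbreviation "F \<equiv> q2.free_eval q2_gen"

lemma free_eval_D3_relations: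
  assumes "r \<in> D3_relations (s * s) (3 * (s * s))"
  shows "F r = 0"
proof -
  have scale: "q2.sc s * p * (q2.sc s * q) = q2.sc (s * s) * (p * q)" for p q
    by (simp only: mult.assoc q2.sc_mult q2.sc_central_left[of p])
  have three: "q2.sc (3 * (s * s)) = q2.sc (s * s) * (1 + 1 + 1)"
    by (simp only: q2.sc_mult[of 3] q2.sc_three) (rule q2.sc_central)
  show ?thesis
    using assms unfolding D3_relations_def Let_def insert_iff empty_iff
    by (elim disjE FalseE; hypsubst)
      (simp_all only: q2.free_eval_simps q2.free_eval_mult q2_gen_def D3_gen.case scale three
        Q.D3_relations_hold Q.sq mult_1_right diff_self flip: distrib_left)
qed

text \<open>The image contains \<sigma>, and 4u and 4v as commutators. Dividing by powers of 2 gives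
  u, v and the idempotents (1 + \<sigma>)/2 and (1 - \<sigma>)/2; these cut u and v into the four
  arrows.\<close>

lemma range_F: "range F = UNIV"
proof -
  have F_add: "p + q \<in> range F" and F_mult: "p * q \<in> range F" and F_diff: "p - q \<in> range F"
    if pq: "p \<in> range F" "q \<in> range F" for p q
  proof -
    obtain a b where ab: "p = F a" "q = F b"
      using pq by blast
    have "F (a + b) = p + q" "F (a * b) = p * q" "F (a - b) = p - q"
      by (simp_all only: ab q2.free_eval_simps q2.free_eval_mult)
    then show "p + q \<in> range F" "p * q \<in> range F" "p - q \<in> range F"
      using range_eqI[of _ F] by metis+
  qed
  have F_const: "q2.sc c \<in> range F" for c
    by (rule range_eqI[of _ _ "free_const c"]) simp
  have cancel: "p \<in> range F" if "q2.sc c * p \<in> range F" "c \<noteq> 0" for c p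
  proof -
    have "q2.sc (1 / c) * (q2.sc c * p) = p"
      using that(2) by (simp add: q2.sc_one flip: mult.assoc q2.sc_mult)
    then show ?thesis
      using F_mult[OF F_const that(1), of "1 / c"] by simp
  qed
  have gen: "\<sigma>\<^sub>Q \<in> range F" "\<sigma>\<^sub>Q * exp2 u\<^sub>Q \<in> range F" "\<sigma>\<^sub>Q * exp2 (u\<^sub>Q + v\<^sub>Q) \<in> range F"
  proof -
    have F_gen: "q2_gen g \<in> range F" for g
      by (rule range_eqI[of _ _ "free_gen g"]) simp
    have "(case g of GenA \<Rightarrow> \<sigma>\<^sub>Q | GenB \<Rightarrow> \<sigma>\<^sub>Q * exp2 u\<^sub>Q | GenC \<Rightarrow> \<sigma>\<^sub>Q * exp2 (u\<^sub>Q + v\<^sub>Q)) \<in> range F" for g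
      by (rule cancel[OF _ s]) (rule F_gen[of g, unfolded q2_gen_def[of g]])
    from this[of GenA] this[of GenB] this[of GenC]
    show "\<sigma>\<^sub>Q \<in> range F" "\<sigma>\<^sub>Q * exp2 u\<^sub>Q \<in> range F" "\<sigma>\<^sub>Q * exp2 (u\<^sub>Q + v\<^sub>Q) \<in> range F"
      by (simp_all only: D3_gen.case)
  qed
  have double: "q2.sc (2 :: 'k) * p = p + p" for p
  proof -
    have "q2.sc 2 = (1 + 1 :: 'k q2)"
      using q2.sc_add[of 1 1] by (simp only: q2.sc_one one_add_one)
    then show ?thesis by (simp only: distrib_right mult_1_left)
  qed
  have halve: "p \<in> range F" if "p + p \<in> range F" for p
    using cancel[of 2 p] two that double by simp
  have quarter: "p \<in> range F" if "p + p + p + p \<in> range F" for p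
    using halve[of "p + p"] halve[of p] that by (simp add: add.assoc)
  have u: "u\<^sub>Q \<in> range F"
    by (rule quarter, subst Q.D3_relations_hold(5)[symmetric]) (intro F_diff F_mult gen)
  have v: "v\<^sub>Q \<in> range F"
    by (rule quarter, subst Q.D3_relations_hold(6)[symmetric]) (intro F_diff F_mult gen)
  have one: "1 \<in> range F"
    using F_const[of 1] by (simp only: q2.sc_one)
  have e1: "q2_vertex 1 \<in> range F"
  proof (rule halve)
    have "q2_vertex 1 + q2_vertex 1 = (q2_vertex 1 + q2_vertex 2) + \<sigma>\<^sub>Q"
      by simp
    also have "\<dots> \<in> range F"
      unfolding q2_vertex_sum by (intro F_add one gen)
    finally show "q2_vertex 1 + q2_vertex 1 \<in> range F" .
  qed
  have e2: "q2_vertex 2 \<in> range F"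
    using F_diff[OF one e1] by (simp flip: q2_vertex_sum)
  have arrows: "q2.cls (arr_u 1 2) \<in> range F" "q2.cls (arr_v 1 2) \<in> range F"
    "q2.cls (arr_u 2 1) \<in> range F" "q2.cls (arr_v 2 1) \<in> range F"
    using F_mult[OF e1 u] F_mult[OF e1 v] F_mult[OF e2 u] F_mult[OF e2 v]
    by (simp_all add: distrib_left q2.sources q2.vanishing del: One_nat_def)
  have "q2.cls f \<in> range F" if "f \<in> carrier (path_algebra Q2)" for f
    using that
  proof (induction f rule: Q2.path_algebra_induct)
    case (vertex w)
    then have "w = 1 \<or> w = 2" by (auto simp: Q2_def)
    then show ?case using e1 e2 by (auto simp: q2_vertex_def)
  next
    case (arrow a)
    then have "a = (U, 1, 2) \<or> a = (V, 1, 2) \<or> a = (U, 2, 1) \<or> a = (V, 2, 1)"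
      by (auto simp: Q2_def)
    then show ?case using arrows unfolding arr_u_def arr_v_def by blast
  next
    case (add f g)
    then show ?case by (simp add: cls_q2_simps F_add)
  next
    case (mult f g)
    then show ?case by (simp add: cls_q2_simps F_mult)
  next
    case (scale k f)
    then show ?case using F_mult[OF F_const[of k]] q2.cls_smult[of f k] by simp
  next
    case zero
    show ?case using F_const[of 0] by (simp add: cls_q2_zero q2.sc_zero)
  qed
  note F_cls = this
  show ?thesis
  proof (intro equalityI subset_UNIV subsetI)
    fix t :: "'k q2"
    obtain f where "f \<in> carrier (path_algebra Q2)" "t = q2.cls f"
      by (rule q2.cls_surj)
    then show "t \<in> range F"
      by (simp only: F_cls)
  qed
qed

abbreviation "rescale \<equiv> central_scalars.free_eval free_const
  (\<lambda>g. free_const s * free_gen g :: D3_gen free_monoid \<Rightarrow>\<^sub>0 'k)"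

text \<open>
  This replaces an inverse of \<^term>\<open>F\<close>: if \<^term>\<open>F p = 0\<close>, the common lift lies in the ideal of the
  relations, which the homomorphism to \<open>\<D>\<^sub>3(1, 3)\<close> kills.
\<close>

lemma common_lift:
  "\<exists>f \<in> carrier (path_algebra Q2). q2.cls f = F p \<and> G.path_eval f = d3.cls (rescale p)"
proof -
  interpret R: central_scalars "free_const :: 'k \<Rightarrow> (D3_gen free_monoid \<Rightarrow>\<^sub>0 'k)"
    by (rule central_scalars_free_const)
  \<comment> \<open>\<open>L\<close> is the image of the path algebra in the product of the two ring
    types. Its closure under the operations lets pairs be built up from vertices and arrows without
    naming the lifts.\<close>
  define L where "L = (\<lambda>f. (q2.cls f, G.path_eval f)) ` carrier (path_algebra Q2 :: ('k, _) module)"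
  have L: "(q2.cls f, G.path_eval f) \<in> L" if "Poly_Mapping.keys f \<subseteq> paths Q2" for f
    using that by (auto simp: L_def)
  have L_add: "(p + q, p' + q') \<in> L" and L_diff: "(p - q, p' - q') \<in> L" and L_mult: "(p * q, p' * q') \<in> L"
    if pq: "(p, p') \<in> L" "(q, q') \<in> L" for p p' q q'
  proof -
    obtain f g where f: "Poly_Mapping.keys f \<subseteq> paths Q2" "p = q2.cls f" "p' = G.path_eval f"
      and g: "Poly_Mapping.keys g \<subseteq> paths Q2" "q = q2.cls g" "q' = G.path_eval g"
      using pq by (auto simp: L_def)
    show "(p + q, p' + q') \<in> L" "(p - q, p' - q') \<in> L" "(p * q, p' * q') \<in> L"
      using L[of "f + g"] L[of "f - g"] L[of "f \<star> g"] f g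
      by (simp_all add: cls_q2_simps G.path_eval_mult keys_add_closed keys_diff_closed Q2.path_mult_closed)
  qed
  have L_const: "(q2.sc c, d3.sc c) \<in> L" for c
  proof -
    have "q2.cls (Poly_Mapping.map ((*) c) \<one>\<^bsub>path_algebra Q2\<^esub>) = q2.sc c"
      by (simp add: q2.sc_def)
    moreover have "G.path_eval (Poly_Mapping.map ((*) c) \<one>\<^bsub>path_algebra Q2\<^esub>) = d3.sc c"
      by (simp only: path_algebra_simps G.path_eval_simps G.path_eval_one mult_1_right)
    moreover have "Poly_Mapping.map ((*) c) (\<one>\<^bsub>path_algebra Q2\<^esub> :: _ \<Rightarrow>\<^sub>0 'k) \<in> carrier (path_algebra Q2)"
      using q2.smult_closed[OF q2.one_closed, of c] by simp
    ultimately show ?thesis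
      unfolding L_def by (metis (no_types, lifting) image_eqI)
  qed
  have vertex: "(q2_vertex i, d3_vertex i) \<in> L" if "i \<in> {1, 2}" for i
    using L[of "Poly_Mapping.single (i, [], i) 1"] that Q2.vertex_path[of i]
    by (simp add: q2_vertex_def Q2_def d3.sc_one)
  have arrow: "(q2.cls (arr_u i j), d3_vertex i * D.u) \<in> L" "(q2.cls (arr_v i j), d3_vertex i * D.v) \<in> L"
    if ij: "(i, j) \<in> {(1, 2), (2, 1)}" for i j
  proof -
    have "G.path_eval (arr_u i j) = d3_vertex i * D.u" "G.path_eval (arr_v i j) = d3_vertex i * D.v"
      unfolding arr_u_def arr_v_def using ij
      by (subst G.path_eval_arrow; simp only: arcs_Q2_iff d3_arrow_def prod.case arrow_label.case)+
    then show "(q2.cls (arr_u i j), d3_vertex i * D.u) \<in> L" "(q2.cls (arr_v i j), d3_vertex i * D.v) \<in> L"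
      using L arr_closed[OF ij] by metis+
  qed
  have sum: "d3_vertex 1 * p + d3_vertex 2 * p = p" for p
    using D.unit by (simp add: d3_vertex_def flip: distrib_right)
  have \<sigma>: "(\<sigma>\<^sub>Q, x\<^sub>D) \<in> L"
    using L_diff[OF vertex[of 1] vertex[of 2]] by (simp add: d3_vertex_def D.sigma)
  have u: "(u\<^sub>Q, D.u) \<in> L"
    using L_add[OF arrow(1)[of 1 2] arrow(1)[of 2 1]] by (simp only: sum insert_iff simp_thms)
  have v: "(v\<^sub>Q, D.v) \<in> L"
    using L_add[OF arrow(2)[of 1 2] arrow(2)[of 2 1]] by (simp only: sum insert_iff simp_thms)
  have one: "(1, 1) \<in> L"
    using L_const[of 1] by (simp only: q2.sc_one d3.sc_one)
  have exp: "(exp2 p, exp2 p') \<in> L" if "(p, p') \<in> L" for p p'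
    unfolding exp2_def by (intro L_add L_mult one that)
  \<comment> \<open>The same expression in \<sigma>, u, v is evaluated on both sides: it defines
    \<open>q2_gen\<close> on the left, and on the right the exponential identities in D_3(1, 3)
    collapse it to \<open>s\<close> times a generator.\<close>
  have L_gen: "(q2_gen g, d3.sc s * d3.cls (free_gen g)) \<in> L" for g
  proof (cases g)
    case GenA
    then show ?thesis using L_mult[OF L_const \<sigma>] by (simp add: q2_gen_def)
  next
    case GenB
    then show ?thesis
      using L_mult[OF L_const L_mult[OF \<sigma> exp[OF u]]] by (simp add: q2_gen_def D.exp2_u)
  next
    case GenC
    then show ?thesis
      using L_mult[OF L_const L_mult[OF \<sigma> exp[OF L_add[OF u v]]]] by (simp add: q2_gen_def D.exp2_u_v)
  qed
  have "(F p, d3.cls (rescale p)) \<in> L"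
  proof (induction p rule: free_algebra_induct)
    case (const c)
    show ?case by (simp add: cls_d3_simps L_const)
  next
    case (gen g)
    show ?case by (simp add: cls_d3_simps L_gen)
  next
    case (add p q)
    then show ?case by (simp add: cls_d3_simps L_add)
  next
    case (mult p q)
    then show ?case by (simp add: cls_d3_simps L_mult)
  qed
  then show ?thesis
    unfolding L_def by auto
qed

lemma kernel_F: "Idl\<^bsub>free_algebra\<^esub> (D3_relations (s * s) (3 * (s * s))) = {p \<in> carrier free_algebra. F p = 0}"
proof (intro equalityI subsetI)
  interpret h: ring_hom_ring free_algebra "type_algebra q2.sc" F
    by (rule q2.free_eval_hom)
  fix p assume "p \<in> Idl\<^bsub>free_algebra\<^esub> (D3_relations (s * s) (3 * (s * s)))"
  then have "F p = \<zero>\<^bsub>type_algebra q2.sc\<^esub>"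
    by (rule h.vanishes_on_genideal[rotated 2]) (simp_all add: free_eval_D3_relations)
  then show "p \<in> {p \<in> carrier free_algebra. F p = 0}"
    by simp
next
  interpret g: ring_hom_ring "path_algebra Q2" "type_algebra d3.sc" G.path_eval
    by (rule G.path_eval_hom)
  fix p assume "p \<in> {p \<in> carrier free_algebra. F p = 0}"
  then obtain f where f: "f \<in> carrier (path_algebra Q2)" "q2.cls f = 0" "G.path_eval f = d3.cls (rescale p)"
    using common_lift[of p] by auto
  then have "f \<in> Idl\<^bsub>path_algebra Q2\<^esub> Q2_relations"
    using q2.cls_eq_zero_iff by blast
  then have "G.path_eval f = \<zero>\<^bsub>type_algebra d3.sc\<^esub>"
    by (rule g.vanishes_on_genideal[OF Q2_relations_closed, rotated]) (simp add: path_eval_Q2_relations)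
  \<comment> \<open>The lift evaluates to 0 and to the class of \<open>rescale p\<close>; this
    settles D_3(1, 3), and rescaling returns to the given parameter.\<close>
  then have "rescale p \<in> Idl\<^bsub>free_algebra\<^esub> (D3_relations 1 3)"
    using f(3) by (subst d3.cls_eq_zero_iff[symmetric]) simp_all
  then show "p \<in> Idl\<^bsub>free_algebra\<^esub> (D3_relations (s * s) (3 * (s * s)))"
    by (rule D3_ideal_rescale[OF s])
qed

lemma algebra_isomorphic_D3_square: "algebra_isomorphic (D3 (s * s) (3 * (s * s))) (Q2_algebra :: ('k, _) module)"
  unfolding D3_def presented_algebra_def
  by (rule q2.algebra_isomorphic_quot[OF algebra_ideal_D3 q2.free_eval_hom[of q2_gen]])
    (simp_all add: range_F kernel_F)

end

theorem proposition2p17: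
  fixes \<alpha>\<^sub>1 :: "'k::alg_closed_field"
  assumes "CHAR('k) \<noteq> 2"
    and "\<alpha>\<^sub>1 \<noteq> 0"
  shows "algebra_isomorphic (D3 \<alpha>\<^sub>1 (3 * \<alpha>\<^sub>1))
           (presented_algebra (path_algebra Q2) Q2_relations)"
proof -
  have "(2 :: 'k) \<noteq> 0"
  proof
    assume "(2 :: 'k) = 0"
    then have "of_nat 2 = (0 :: 'k)" by simp
    then have "CHAR('k) dvd 2"
      by (simp only: of_nat_eq_0_iff_char_dvd)
    moreover have "CHAR('k) \<noteq> 1" by simp
    ultimately show False
      using assms(1) by (metis primes_dvd_imp_eq two_is_prime_nat prime_nat_iff)
  qed
  \<comment> \<open>Algebraic closedness enters only here, for a square root of
    \<open>\<alpha>\<^sub>1\<close>.\<close>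
  moreover obtain s where s: "s ^ 2 = \<alpha>\<^sub>1"
    using nth_root_exists[of 2 \<alpha>\<^sub>1] by auto
  moreover have "s \<noteq> 0"
    using s assms(2) by auto
  ultimately show ?thesis
    using algebra_isomorphic_D3_square[of s] by (simp add: power2_eq_square)
qed

end
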